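(* Any abelian subgroup of a diagram group is free abelian.
   Context: Diagram groups. A semigroup presentation $\mathcal{P}=\langle\Sigma\mid\mathcal{R}\rangle$ consists of an alphabet $\Sigma$ and a set $\mathcal{R}$ of pairs $(u,v)$ of non-empty words over $\Sigma$, written $u=v$; presentations are assumed anti-symmetric: if $(u=v)\in\mathcal{R}$ then $(v=u)\notin\mathcal{R}$. $\Sigma^+$ and $\Sigma^*$ are the free semigroup and free monoid on $\Sigma$. The graph $\Gamma(\mathcal{P})$ has vertex set $\Sigma^+$ and an edge $(p,u\to v,q)$ from $puq$ to $pvq$ for all $p,q\in\Sigma^*$ and all $u,v$ with $(u=v)\in\mathcal{R}$ or $(v=u)\in\mathcal{R}$; the inverse edge is $(p,v\to u,q)$. The Squier complex $\mathcal{K}(\mathcal{P})$ is the 2-complex obtained from $\Gamma(\mathcal{P})$ by attaching, for all $p,z,q\in\Sigma^*$ and $(\ell_1=r_1),(\ell_2=r_2)\in\mathcal{R}$, a 2-cell along the closed path $p_1p_2^{-1}$, where $p_1=(p,\ell_1\to r_1,z\ell_2q)(pr_1z,\ell_2\to r_2,q)$ and $p_2=(p\ell_1z,\ell_2\to r_2,q)(p,\ell_1\to r_1,zr_2q)$. For $w\in\Sigma^+$ the diagram group $\mathcal{D}(\mathcal{P},w)$ is (up to isomorphism, by Kilibarda's theorem; this may be taken as the definition) the fundamental group $\pi_1(\mathcal{K}(\mathcal{P}),w)$. A group is a diagram group if it is isomorphic to some $\mathcal{D}(\mathcal{P},w)$. *)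

theory Defs
  imports "HOL-Algebra.Free_Abelian_Groups"
begin

section \<open>Combinatorial 2-complexes and their fundamental groups\<close>

text \<open>
  A graph in the sense of Serre (every geometric edge is a pair of mutually inverse oriented
  edges) together with the closed edge paths along which 2-cells are attached.
\<close>

record ('v, 'e) complex2 =
  verts :: "'v set"
  edges :: "'e set"
  src :: "'e \<Rightarrow> 'v"
  tgt :: "'e \<Rightarrow> 'v"
  einv :: "'e \<Rightarrow> 'e"
  cells :: "'e list set"

fun edge_path :: "('v, 'e, 'm) complex2_scheme \<Rightarrow> 'v \<Rightarrow> 'e list \<Rightarrow> 'v \<Rightarrow> bool" where
  "edge_path K a [] b \<longleftrightarrow> a \<in> verts K \<and> b = a"
| "edge_path K a (e # es) b \<longleftrightarrow>
     a \<in> verts K \<and> e \<in> edges K \<and> src K e = a \<and> edge_path K (tgt K e) es b"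

definition inv_path :: "('v, 'e, 'm) complex2_scheme \<Rightarrow> 'e list \<Rightarrow> 'e list" where
  "inv_path K p = rev (map (einv K) p)"

locale complex2 =
  fixes K :: "('v, 'e, 'm) complex2_scheme" (structure)
  assumes src_verts: "e \<in> edges K \<Longrightarrow> src K e \<in> verts K"
    and tgt_verts: "e \<in> edges K \<Longrightarrow> tgt K e \<in> verts K"
    and einv_edges: "e \<in> edges K \<Longrightarrow> einv K e \<in> edges K"
    and einv_neq: "e \<in> edges K \<Longrightarrow> einv K e \<noteq> e"
    and einv_einv: "e \<in> edges K \<Longrightarrow> einv K (einv K e) = e"
    and src_einv: "e \<in> edges K \<Longrightarrow> src K (einv K e) = tgt K e"
    and cells_closed: "c \<in> cells K \<Longrightarrow> \<exists>a. edge_path K a c a"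

text \<open>
  Inserting a backtracking \<open>e e\<^sup>-\<^sup>1\<close> or the boundary path of a 2-cell into a path from
  \<open>a\<close> to \<open>b\<close>. Boundary paths read backwards, or from another starting point, need not be
  included: they become insertable in the generated equivalence relation.
\<close>

inductive elementary_homotopy ::
  "('v, 'e, 'm) complex2_scheme \<Rightarrow> 'v \<Rightarrow> 'v \<Rightarrow> 'e list \<Rightarrow> 'e list \<Rightarrow> bool"
  for K a b where
  backtrack: "edge_path K a (p @ q) b \<Longrightarrow> edge_path K a (p @ [e, einv K e] @ q) b
    \<Longrightarrow> elementary_homotopy K a b (p @ q) (p @ [e, einv K e] @ q)"
| cell: "edge_path K a (p @ q) b \<Longrightarrow> edge_path K a (p @ c @ q) b \<Longrightarrow> c \<in> cells K
    \<Longrightarrow> elementary_homotopy K a b (p @ q) (p @ c @ q)"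

definition homotopy :: "('v, 'e, 'm) complex2_scheme \<Rightarrow> 'v \<Rightarrow> 'v \<Rightarrow> 'e list rel" where
  "homotopy K a b =
     {(p, q). edge_path K a p b \<and> edge_path K a q b \<and> equivclp (elementary_homotopy K a b) p q}"

definition loops :: "('v, 'e, 'm) complex2_scheme \<Rightarrow> 'v \<Rightarrow> 'e list set" where
  "loops K a = {p. edge_path K a p a}"

definition fundamental_group :: "('v, 'e, 'm) complex2_scheme \<Rightarrow> 'v \<Rightarrow> 'e list set monoid" where
  "fundamental_group K a =
     \<lparr>carrier = loops K a // homotopy K a a,
      monoid.mult = (\<lambda>X Y. \<Union>p\<in>X. \<Union>q\<in>Y. homotopy K a a `` {p @ q}),
      one = homotopy K a a `` {[]}\<rparr>"


section \<open>Semigroup presentations and diagram groups\<close>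

definition words1 :: "'s set \<Rightarrow> 's list set" where
  "words1 \<Sigma> = lists \<Sigma> - {[]}"

definition semigroup_presentation :: "'s set \<Rightarrow> 's list rel \<Rightarrow> bool" where
  "semigroup_presentation \<Sigma> R \<longleftrightarrow>
     R \<subseteq> words1 \<Sigma> \<times> words1 \<Sigma> \<and> (\<forall>u v. (u, v) \<in> R \<longrightarrow> (v, u) \<notin> R)"

text \<open>The tuple \<open>(p, u, v, q)\<close> stands for the edge \<open>(p, u \<rightarrow> v, q)\<close>.\<close>

type_synonym 's squier_edge = "'s list \<times> 's list \<times> 's list \<times> 's list"

definition squier_complex ::
  "'s set \<Rightarrow> 's list rel \<Rightarrow> ('s list, 's squier_edge) complex2" where
  "squier_complex \<Sigma> R =
     \<lparr>verts = words1 \<Sigma>,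
      edges = {(p, u, v, q). p \<in> lists \<Sigma> \<and> q \<in> lists \<Sigma> \<and> ((u, v) \<in> R \<or> (v, u) \<in> R)},
      src = (\<lambda>(p, u, v, q). p @ u @ q),
      tgt = (\<lambda>(p, u, v, q). p @ v @ q),
      einv = (\<lambda>(p, u, v, q). (p, v, u, q)),
      cells = {[(p, l\<^sub>1, r\<^sub>1, z @ l\<^sub>2 @ q), (p @ r\<^sub>1 @ z, l\<^sub>2, r\<^sub>2, q),
                (p, r\<^sub>1, l\<^sub>1, z @ r\<^sub>2 @ q), (p @ l\<^sub>1 @ z, r\<^sub>2, l\<^sub>2, q)]
               | p z q l\<^sub>1 r\<^sub>1 l\<^sub>2 r\<^sub>2.
                 p \<in> lists \<Sigma> \<and> z \<in> lists \<Sigma> \<and> q \<in> lists \<Sigma> \<and> (l\<^sub>1, r\<^sub>1) \<in> R \<and> (l\<^sub>2, r\<^sub>2) \<in> R}\<rparr>"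

text \<open>
  Each attaching path is \<open>p\<^sub>1 p\<^sub>2\<^sup>-\<^sup>1\<close> for the two orders in which disjoint occurrences of
  \<open>l\<^sub>1\<close> and \<open>l\<^sub>2\<close> can be rewritten.
\<close>

lemma squier_cells:
  "cells (squier_complex \<Sigma> R) =
     {[(p, l\<^sub>1, r\<^sub>1, z @ l\<^sub>2 @ q), (p @ r\<^sub>1 @ z, l\<^sub>2, r\<^sub>2, q)]
        @ inv_path (squier_complex \<Sigma> R) [(p @ l\<^sub>1 @ z, l\<^sub>2, r\<^sub>2, q), (p, l\<^sub>1, r\<^sub>1, z @ r\<^sub>2 @ q)]
      | p z q l\<^sub>1 r\<^sub>1 l\<^sub>2 r\<^sub>2.
        p \<in> lists \<Sigma> \<and> z \<in> lists \<Sigma> \<and> q \<in> lists \<Sigma> \<and> (l\<^sub>1, r\<^sub>1) \<in> R \<and> (l\<^sub>2, r\<^sub>2) \<in> R}"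
  by (simp add: squier_complex_def inv_path_def)

definition diagram_group :: "'s set \<Rightarrow> 's list rel \<Rightarrow> 's list \<Rightarrow> 's squier_edge list set monoid" where
  "diagram_group \<Sigma> R w = fundamental_group (squier_complex \<Sigma> R) w"


section \<open>Free abelian groups\<close>

text \<open>
  Taking the index set inside the type of the group elements is no restriction: a basis of a
  free abelian group is a subset of its carrier.
\<close>

definition free_abelian :: "('g, 'm) monoid_scheme \<Rightarrow> bool" where
  "free_abelian G \<longleftrightarrow> (\<exists>B :: 'g set. G \<cong> free_Abelian_group B)"


section \<open>Well-definedness\<close>

lemma edge_path_append:
  "edge_path K a (p @ q) b \<longleftrightarrow> (\<exists>c. edge_path K a p c \<and> edge_path K c q b)"
proof (induction p arbitrary: a)
  case Nil
  have "edge_path K a q b \<Longrightarrow> a \<in> verts K" by (cases q) auto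
  then show ?case by auto
qed auto

lemma elementary_homotopy_paths:
  "elementary_homotopy K a b p q \<Longrightarrow> edge_path K a p b \<and> edge_path K a q b"
  by (induction rule: elementary_homotopy.induct) auto

lemma homotopy_context:
  assumes "(p, q) \<in> homotopy K b c" "edge_path K a x b" "edge_path K c y d"
  shows "(x @ p @ y, x @ q @ y) \<in> homotopy K a d"
proof -
  have elem: "elementary_homotopy K a d (x @ u @ y) (x @ v @ y)"
    if "elementary_homotopy K b c u v" for u v
    using that
  proof cases
    case (backtrack p q e)
    have "edge_path K a ((x @ p) @ q @ y) d" "edge_path K a ((x @ p) @ [e, einv K e] @ q @ y) d"
      using backtrack(3,4) assms(2,3) by (simp_all only: edge_path_append) blast+
    from elementary_homotopy.backtrack[OF this] show ?thesis
      using backtrack by simp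
  next
    case (cell p q e)
    have "edge_path K a ((x @ p) @ q @ y) d" "edge_path K a ((x @ p) @ e @ q @ y) d"
      using cell(3,4) assms(2,3) by (simp_all only: edge_path_append) blast+
    from elementary_homotopy.cell[OF this cell(5)] show ?thesis
      using cell by simp
  qed
  have "equivclp (elementary_homotopy K b c) p q" and
    pq: "edge_path K b p c" "edge_path K b q c"
    using assms(1) by (auto simp: homotopy_def)
  from this(1) have "equivclp (elementary_homotopy K a d) (x @ p @ y) (x @ q @ y)"
  proof (induction rule: equivclp_induct)
    case (step u v)
    then show ?case
      using elem by (meson equivclp_into_equivclp)
  qed simp
  then show ?thesis
    using pq assms(2,3) unfolding homotopy_def by (auto simp: edge_path_append)
qed

lemma equiv_homotopy: "equiv (loops K a) (homotopy K a a)"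
  by (intro equivI refl_onI symI transI)
    (auto simp: homotopy_def loops_def intro: equivclp_sym equivclp_trans)

lemma homotopy_append:
  assumes "(p, p') \<in> homotopy K a a" "(q, q') \<in> homotopy K a a"
  shows "(p @ q, p' @ q') \<in> homotopy K a a"
proof -
  have P: "edge_path K a p' a" "edge_path K a q a" "edge_path K a [] a"
    using assms by (auto simp: homotopy_def) (cases q; auto)
  have "(p @ q, p' @ q) \<in> homotopy K a a" "(p' @ q, p' @ q') \<in> homotopy K a a"
    using homotopy_context[OF assms(1) P(3,2)] homotopy_context[OF assms(2) P(1,3)] by simp_all
  then show ?thesis
    using equiv_homotopy[of K a] by (meson equivE transE)
qed

lemma mult_fundamental_group:
  assumes "p \<in> loops K a" "q \<in> loops K a"
  shows "homotopy K a a `` {p} \<otimes>\<^bsub>fundamental_group K a\<^esub> homotopy K a a `` {q}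
    = homotopy K a a `` {p @ q}"
proof -
  have "(\<Union>x\<in>homotopy K a a `` {p}. \<Union>y\<in>homotopy K a a `` {q}. homotopy K a a `` {x @ y})
    = homotopy K a a `` {p @ q}"
    by (rule UN_equiv_class2[OF equiv_homotopy equiv_homotopy _ assms])
      (auto simp: congruent2_def intro!: equiv_class_eq[OF equiv_homotopy] homotopy_append)
  then show ?thesis by (simp add: fundamental_group_def)
qed

context complex2
begin

lemma tgt_einv: "e \<in> edges K \<Longrightarrow> tgt K (einv K e) = src K e"
  by (metis einv_edges einv_einv src_einv)

lemma edge_path_verts: "edge_path K a p b \<Longrightarrow> a \<in> verts K \<and> b \<in> verts K"
  by (induction p arbitrary: a) auto

lemma edge_path_inv: "edge_path K a p b \<Longrightarrow> edge_path K b (inv_path K p) a"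
proof (induction p arbitrary: a)
  case (Cons e p)
  then have "edge_path K b (inv_path K p) (tgt K e)" "edge_path K (tgt K e) [einv K e] a"
    by (auto simp: src_einv tgt_einv einv_edges src_verts tgt_verts)
  then have "edge_path K b (inv_path K p @ [einv K e]) a"
    unfolding edge_path_append by blast
  then show ?case by (simp add: inv_path_def)
qed (auto simp: inv_path_def)

lemma inv_path_homotopy:
  "edge_path K a p b \<Longrightarrow> (inv_path K p @ p, []) \<in> homotopy K b b"
proof (induction p arbitrary: a)
  case Nil
  then show ?case by (simp add: inv_path_def homotopy_def)
next
  case (Cons e p)
  let ?c = "tgt K e" and ?i = "inv_path K p"
  have e: "e \<in> edges K" and p: "edge_path K ?c p b" using Cons.prems by auto
  have "edge_path K ?c [einv K e, einv K (einv K e)] ?c"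
    using e by (auto simp: src_einv tgt_einv einv_edges einv_einv src_verts tgt_verts)
  moreover have "edge_path K ?c [] ?c" using e by (simp add: tgt_verts)
  ultimately have "elementary_homotopy K ?c ?c [] [einv K e, einv K (einv K e)]"
    using elementary_homotopy.backtrack[of K ?c "[]" "[]" ?c "einv K e"] by simp
  then have "([einv K e, e], []) \<in> homotopy K ?c ?c"
    using e by (auto simp: homotopy_def src_einv tgt_einv einv_edges einv_einv src_verts tgt_verts
        intro: equivclp_sym)
  from homotopy_context[OF this edge_path_inv[OF p] p]
  have "(inv_path K (e # p) @ e # p, ?i @ p) \<in> homotopy K b b"
    by (simp add: inv_path_def)
  then show ?case
    using Cons.IH[OF p] equiv_homotopy[of K b] by (meson equivE transE)
qed

lemma group_fundamental_group:
  assumes "a \<in> verts K"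
  shows "group (fundamental_group K a)"
proof -
  let ?G = "fundamental_group K a" and ?c = "\<lambda>p. homotopy K a a `` {p}"
  have car: "carrier ?G = ?c ` loops K a"
    by (auto simp: fundamental_group_def quotient_def)
  have nil: "[] \<in> loops K a" using assms by (simp add: loops_def)
  have one: "\<one>\<^bsub>?G\<^esub> = ?c []" by (simp add: fundamental_group_def)
  have app: "p @ q \<in> loops K a" if "p \<in> loops K a" "q \<in> loops K a" for p q
    using that by (auto simp: loops_def edge_path_append)
  show ?thesis
  proof (rule groupI)
    fix x y assume "x \<in> carrier ?G" "y \<in> carrier ?G"
    then show "x \<otimes>\<^bsub>?G\<^esub> y \<in> carrier ?G"
      by (auto simp: car mult_fundamental_group app)
  next
    show "\<one>\<^bsub>?G\<^esub> \<in> carrier ?G" using nil by (simp add: car one)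
  next
    fix x y z assume "x \<in> carrier ?G" "y \<in> carrier ?G" "z \<in> carrier ?G"
    then show "x \<otimes>\<^bsub>?G\<^esub> y \<otimes>\<^bsub>?G\<^esub> z = x \<otimes>\<^bsub>?G\<^esub> (y \<otimes>\<^bsub>?G\<^esub> z)"
      by (auto simp: car mult_fundamental_group app)
  next
    fix x assume "x \<in> carrier ?G"
    then obtain p where p: "p \<in> loops K a" "x = ?c p" by (auto simp: car)
    show "\<one>\<^bsub>?G\<^esub> \<otimes>\<^bsub>?G\<^esub> x = x"
      using p nil by (simp add: one mult_fundamental_group)
    have "inv_path K p \<in> loops K a" "(inv_path K p @ p, []) \<in> homotopy K a a"
      using p edge_path_inv inv_path_homotopy by (auto simp: loops_def)
    moreover from this(2) have "?c (inv_path K p @ p) = ?c []"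
      by (rule equiv_class_eq[OF equiv_homotopy])
    ultimately show "\<exists>y\<in>carrier ?G. y \<otimes>\<^bsub>?G\<^esub> x = \<one>\<^bsub>?G\<^esub>"
      using p by (auto simp: car one mult_fundamental_group intro!: bexI[of _ "inv_path K p"])
  qed
qed

end

lemma complex2_squier_complex:
  assumes "semigroup_presentation \<Sigma> R"
  shows "complex2 (squier_complex \<Sigma> R)"
proof -
  have rel: "u \<in> lists \<Sigma>" "v \<in> lists \<Sigma>" "u \<noteq> []" "v \<noteq> []" "u \<noteq> v" if "(u, v) \<in> R" for u v
    using assms that by (auto simp: semigroup_presentation_def words1_def)
  have letters: "x \<in> \<Sigma>" if "(u, v) \<in> R" "x \<in> set u \<or> x \<in> set v" for u v x
    using rel[OF that(1)] that(2) by auto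
  show ?thesis
  proof
    fix c assume "c \<in> cells (squier_complex \<Sigma> R)"
    then obtain p z q l1 r1 l2 r2 where
      c: "c = [(p, l1, r1, z @ l2 @ q), (p @ r1 @ z, l2, r2, q),
               (p, r1, l1, z @ r2 @ q), (p @ l1 @ z, r2, l2, q)]"
      and w: "p \<in> lists \<Sigma>" "z \<in> lists \<Sigma>" "q \<in> lists \<Sigma>" "(l1, r1) \<in> R" "(l2, r2) \<in> R"
      unfolding squier_complex_def complex2.select_convs by blast
    then have "edge_path (squier_complex \<Sigma> R) (p @ l1 @ z @ l2 @ q) c (p @ l1 @ z @ l2 @ q)"
      using rel[OF w(4)] rel[OF w(5)] by (simp add: squier_complex_def words1_def)
    then show "\<exists>a. edge_path (squier_complex \<Sigma> R) a c a" by blast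
  qed (auto simp: squier_complex_def words1_def in_lists_conv_set dest: rel letters)
qed

lemma group_diagram_group:
  assumes "semigroup_presentation \<Sigma> R" "w \<in> words1 \<Sigma>"
  shows "group (diagram_group \<Sigma> R w)"
proof -
  interpret complex2 "squier_complex \<Sigma> R" by (rule complex2_squier_complex[OF assms(1)])
  show ?thesis
    using group_fundamental_group[of w] assms(2) by (simp add: diagram_group_def squier_complex_def)
qed

end

theory Submission
  imports Defs
begin

text \<open>
  The Squier complex is the part of dimension at most two of a nonpositively curved cube
  complex: the edges leaving a word are the occurrences of relator sides in it, disjoint
  occurrences can be rewritten independently and so span a square, and three pairwise disjoint
  occurrences span a cube because disjointness of subwords of a word is checked two at a time.
  The walls of such a complex are the classes of parallel edges in its universal cover. Here
  every wall has two distinguishable sides: an edge \<open>u \<rightarrow> v\<close> with \<open>(u, v) \<in> R\<close> keeps its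
  direction when it is pushed across a square.

  Let \<open>A\<close> be a commutative subgroup of the fundamental group. For an \<open>A\<close>-orbit \<open>X\<close> of walls,
  count the crossings of a path with the walls in \<open>X\<close>, with signs. Opposite edges of a square
  contribute equally, so the count only depends on the homotopy class of the path, and on \<open>A\<close> it
  is a homomorphism to the integers. An element of \<open>A\<close> has a nonzero count for finitely many \<open>X\<close>
  only. So \<open>A\<close> maps to a free abelian group, and subgroups of free abelian groups are free
  (\<open>free_abelianI\<close>).

  The point is that this homomorphism is injective. Homotopic paths without cancellation differ
  only by pushing edges across squares (\<open>act_eqv\<close>), which gives a word length and shows that a
  geodesic never crosses a wall twice in opposite directions (\<open>no_both_signs\<close>). An element \<open>g \<noteq>
  1\<close> has a shortest conjugate \<open>c\<close>, and all powers of \<open>c\<close> are geodesic (\<open>shortest_conj_lpow\<close>):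
  \<open>g\<close> has an axis. Suppose that a period of the axis crossed walls of one orbit in opposite
  directions. Then some \<open>a \<in> A\<close> would translate a wall crossed positively by the axis to one
  crossed negatively. Since \<open>a\<close> commutes with \<open>g\<close>, a long segment of the axis and its translate
  by \<open>a\<close> would cross a growing number of common walls in opposite directions, although the end
  points of the two segments stay at a fixed distance from each other; this is impossible
  (\<open>no_opposite_translates\<close>). So the crossings with one orbit all have the same sign, and the
  count for the orbit of any wall on the axis is nonzero (\<open>crossings_detect\<close>).
\<close>

section \<open>Embeddings into free abelian groups\<close>

lemma finite_total_order_max:
  assumes "finite S" "S \<noteq> {}" "S \<subseteq> X" "linear_order_on X r"
  shows "\<exists>i\<in>S. \<forall>j\<in>S. (j, i) \<in> r"
  using assms(1-3)
proof (induction S rule: finite_ne_induct)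
  case (singleton x)
  then show ?case using assms(4)
    by (auto simp: order_on_defs refl_on_def)
next
  case (insert x F)
  then obtain i where i: "i \<in> F" "\<forall>j\<in>F. (j, i) \<in> r" by auto
  have tr: "trans r" and tot: "total_on X r" and re: "refl_on X r"
    using assms(4) by (auto simp: order_on_defs)
  show ?case
  proof (cases "(x, i) \<in> r")
    case True then show ?thesis using i by auto
  next
    case False
    then have "x \<noteq> i" using insert.prems re i by (auto simp: refl_on_def)
    then have "(i, x) \<in> r" using tot False insert.prems i by (auto simp: total_on_def)
    then have "\<forall>j\<in>insert x F. (j, x) \<in> r"
      using i(2) tr re insert.prems by (auto simp: refl_on_def dest: transD)
    then show ?thesis by blast
  qed
qed

text \<open>
  Subgroups of free abelian groups are free, for arbitrary rank. Well-order the coordinates.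
  Among the elements whose largest nonzero coordinate is \<open>i\<close>, choose one, \<open>b i\<close>, whose
  coordinate at \<open>i\<close> is positive and smallest. By division with remainder every element with
  largest coordinate \<open>i\<close> can be moved to smaller coordinates by a multiple of \<open>b i\<close>, so the \<open>b
  i\<close> generate by well-founded induction; a nontrivial combination of them is nonzero at its
  largest index, so they are independent.
\<close>
theorem free_abelianI:
  fixes H :: "('g, 'm) monoid_scheme" and \<phi> :: "'g \<Rightarrow> 'i \<Rightarrow> int"
  assumes "comm_group H"
    and add: "\<And>x y i. x \<in> carrier H \<Longrightarrow> y \<in> carrier H \<Longrightarrow> \<phi> (x \<otimes>\<^bsub>H\<^esub> y) i = \<phi> x i + \<phi> y i"
    and fin: "\<And>x. x \<in> carrier H \<Longrightarrow> finite {i. \<phi> x i \<noteq> 0}"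
    and inj: "\<And>x. x \<in> carrier H \<Longrightarrow> \<forall>i. \<phi> x i = 0 \<Longrightarrow> x = \<one>\<^bsub>H\<^esub>"
  shows "free_abelian H"
proof -
  interpret H: comm_group H by (rule assms(1))
  have phi_hom: "(\<lambda>x. \<phi> x i) \<in> hom H integer_group" for i
    by (rule homI) (auto simp: add)
  have group_phi: "group_hom H integer_group (\<lambda>x. \<phi> x i)" for i
    by (simp add: group_hom_def group_hom_axioms_def phi_hom)
  have pone: "\<phi> \<one>\<^bsub>H\<^esub> i = 0" for i
    using group_hom.hom_one[OF group_phi] by simp
  have pinv: "\<phi> (inv\<^bsub>H\<^esub> x) i = - \<phi> x i" if "x \<in> carrier H" for x i
    using group_hom.hom_inv[OF group_phi that] by simp
  have ppow: "\<phi> (x [^]\<^bsub>H\<^esub> k) i = k * \<phi> x i" if "x \<in> carrier H" for x i and k :: int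
    using group_hom.hom_int_pow[OF group_phi that] by simp
  obtain r :: "'i rel" where r: "well_order_on UNIV r"
    using well_order_on by blast
  then have lin: "linear_order_on UNIV r" and wf: "wf (r - Id)"
    by (auto simp: well_order_on_def)
  have refl: "(i, i) \<in> r" and tr: "(i, j) \<in> r \<Longrightarrow> (j, k) \<in> r \<Longrightarrow> (i, k) \<in> r"
    and asym: "(i, j) \<in> r \<Longrightarrow> (j, i) \<in> r \<Longrightarrow> i = j" for i j k
    using lin by (auto simp: order_on_defs refl_on_def antisym_def dest: transD)
  define K where "K i = {x \<in> carrier H. \<forall>j. \<phi> x j \<noteq> 0 \<longrightarrow> (j, i) \<in> r}" for i
  define J where "J = {i. \<exists>x\<in>K i. \<phi> x i \<noteq> 0}"
  have "\<exists>x\<in>K i. 0 < \<phi> x i \<and> (\<forall>y\<in>K i. 0 < \<phi> y i \<longrightarrow> \<phi> x i \<le> \<phi> y i)" if iJ: "i \<in> J" for i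
  proof -
    obtain x where x: "x \<in> K i" "\<phi> x i \<noteq> 0" using iJ by (auto simp: J_def)
    have xi: "inv\<^bsub>H\<^esub> x \<in> K i" using x by (auto simp: K_def pinv)
    let ?P = "\<lambda>z. z \<in> K i \<and> 0 < \<phi> z i"
    have "\<exists>z. ?P z"
    proof (cases "\<phi> x i > 0")
      case True
      then show ?thesis using x by blast
    next
      case False
      then have "0 < \<phi> (inv\<^bsub>H\<^esub> x) i" using x by (simp add: K_def pinv)
      then show ?thesis using xi by blast
    qed
    then have "is_arg_min (\<lambda>z. nat (\<phi> z i)) ?P (arg_min (\<lambda>z. nat (\<phi> z i)) ?P)"
      by (metis is_arg_min_arg_min_nat)
    then show ?thesis
      by (fastforce simp: is_arg_min_def)
  qed
  then obtain b where b: "\<And>i. i \<in> J \<Longrightarrow> b i \<in> K i \<and> 0 < \<phi> (b i) i"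
    and least: "\<And>i y. i \<in> J \<Longrightarrow> y \<in> K i \<Longrightarrow> 0 < \<phi> y i \<Longrightarrow> \<phi> (b i) i \<le> \<phi> y i"
    by metis
  have bc: "b i \<in> carrier H" if "i \<in> J" for i using b[OF that] by (simp add: K_def)
  define red where "red x i = x \<otimes>\<^bsub>H\<^esub> inv\<^bsub>H\<^esub> (b i [^]\<^bsub>H\<^esub> (\<phi> x i div \<phi> (b i) i))" for x i
  (* Division with remainder by b i at coordinate i. *)
  have redK: "red x i \<in> K i" and red_phi: "\<phi> (red x i) i = \<phi> x i mod \<phi> (b i) i"
    if "i \<in> J" "x \<in> K i" for x i
  proof -
    have x: "x \<in> carrier H" using that by (simp add: K_def)
    note f = add[OF x H.inv_closed[OF H.int_pow_closed[OF bc[OF that(1)]]]]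
      pinv[OF H.int_pow_closed[OF bc[OF that(1)]]] ppow[OF bc[OF that(1)]]
    show "\<phi> (red x i) i = \<phi> x i mod \<phi> (b i) i"
      unfolding red_def f by (simp add: minus_div_mult_eq_mod)
    show "red x i \<in> K i"
    proof -
      have "\<phi> x j \<noteq> 0 \<or> \<phi> (b i) j \<noteq> 0" if "\<phi> (red x i) j \<noteq> 0" for j
        using that by (auto simp: f red_def)
      then show ?thesis
        using that b[OF that(1)] x bc[OF that(1)] unfolding K_def by (auto simp: red_def)
    qed
  qed
  have red0: "\<phi> (red x i) i = 0" if "i \<in> J" "x \<in> K i" for x i
  proof -
    have "\<phi> (red x i) i < \<phi> (b i) i"
      using b[OF that(1)] by (simp add: red_phi[OF that])
    then have "\<not> 0 < \<phi> (red x i) i"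
      using least[OF that(1) redK[OF that]] by linarith
    moreover have "0 \<le> \<phi> (red x i) i"
      using b[OF that(1)] by (simp add: red_phi[OF that])
    ultimately show ?thesis by simp
  qed
  have binj: "inj_on b J"
  proof (rule inj_onI)
    fix i j assume "i \<in> J" "j \<in> J" "b i = b j"
    then have "(i, j) \<in> r" "(j, i) \<in> r"
      using b[of i] b[of j] by (auto simp: K_def)
    then show "i = j" by (rule asym)
  qed
  let ?F = "free_Abelian_group (b ` J)"
  have "(\<lambda>x. x) ` (b ` J) \<subseteq> carrier H" using bc by auto
  then obtain h where h: "h \<in> hom ?F H" and hb: "\<And>x. x \<in> b ` J \<Longrightarrow> h (frag_of x) = x"
    by (rule H.free_Abelian_group_universal) blast
  interpret h: group_hom ?F H h
    using h by (simp add: group_hom_def group_hom_axioms_def)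
  have span: "\<forall>x\<in>K i. x \<in> h ` carrier ?F" for i
  proof (induction i rule: wf_induct_rule[OF wf])
    case (1 i)
    have low: "x \<in> h ` carrier ?F" if x: "x \<in> K i" and z: "\<phi> x i = 0" for x
    proof (cases "\<forall>j. \<phi> x j = 0")
      case True
      then have "x = \<one>\<^bsub>H\<^esub>" using x inj by (simp add: K_def)
      then show ?thesis
        by (metis h.hom_one group.is_monoid group_free_Abelian_group image_eqI monoid.one_closed)
    next
      case False
      then obtain j where j: "\<phi> x j \<noteq> 0" "\<forall>k. \<phi> x k \<noteq> 0 \<longrightarrow> (k, j) \<in> r"
        using finite_total_order_max[OF fin _ _ lin, of x] x by (auto simp: K_def)
      then have "(j, i) \<in> r - Id" using x z by (auto simp: K_def)
      moreover have "x \<in> K j" using x j by (simp add: K_def)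
      ultimately show ?thesis using 1 by blast
    qed
    show ?case
    proof
      fix x assume x: "x \<in> K i"
      show "x \<in> h ` carrier ?F"
      proof (cases "\<phi> x i = 0")
        case True with x low show ?thesis by blast
      next
        case False
        then have i: "i \<in> J" using x by (auto simp: J_def)
        let ?k = "\<phi> x i div \<phi> (b i) i"
        obtain c where c: "c \<in> carrier ?F" "red x i = h c"
          using low[OF redK[OF i x] red0[OF i x]] by blast
        have fb: "frag_of (b i) \<in> carrier ?F" using i by simp
        have xc: "x \<in> carrier H" using x by (simp add: K_def)
        have "x = red x i \<otimes>\<^bsub>H\<^esub> b i [^]\<^bsub>H\<^esub> ?k"
          using xc bc[OF i] by (simp add: red_def H.m_assoc)
        also have "\<dots> = h (c \<otimes>\<^bsub>?F\<^esub> frag_of (b i) [^]\<^bsub>?F\<^esub> ?k)"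
          using c fb i hb[of "b i"] h.hom_int_pow[OF fb]
          by (metis h.hom_mult group.int_pow_closed group_free_Abelian_group imageI)
        finally show ?thesis
          using c(1) fb by (metis group.is_monoid group.int_pow_closed group_free_Abelian_group
              image_eqI monoid.m_closed)
      qed
    qed
  qed
  have surj: "carrier H \<subseteq> h ` carrier ?F"
  proof
    fix x assume x: "x \<in> carrier H"
    show "x \<in> h ` carrier ?F"
    proof (cases "\<forall>j. \<phi> x j = 0")
      case True
      then have "x \<in> K undefined" using x by (simp add: K_def)
      then show ?thesis using span by blast
    next
      case False
      then obtain j where "\<forall>k. \<phi> x k \<noteq> 0 \<longrightarrow> (k, j) \<in> r"
        using finite_total_order_max[OF fin[OF x] _ _ lin] by auto
      then have "x \<in> K j" using x by (simp add: K_def)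
      then show ?thesis using span by blast
    qed
  qed
  have eval: "\<phi> (h c) i = (\<Sum>k\<in>Poly_Mapping.keys c. Poly_Mapping.lookup c k * \<phi> k i)"
    if "Poly_Mapping.keys c \<subseteq> b ` J" for c i
    using that
  proof (rule free_Abelian_group_induct)
    show "\<phi> (h 0) i = (\<Sum>k\<in>Poly_Mapping.keys 0. Poly_Mapping.lookup 0 k * \<phi> k i)"
      using h.hom_one pone by simp
  next
    fix x y :: "'g \<Rightarrow>\<^sub>0 int"
    assume xy: "Poly_Mapping.keys x \<subseteq> b ` J" "Poly_Mapping.keys y \<subseteq> b ` J"
      and IH: "\<phi> (h x) i = (\<Sum>k\<in>Poly_Mapping.keys x. Poly_Mapping.lookup x k * \<phi> k i)"
        "\<phi> (h y) i = (\<Sum>k\<in>Poly_Mapping.keys y. Poly_Mapping.lookup y k * \<phi> k i)"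
    let ?S = "Poly_Mapping.keys x \<union> Poly_Mapping.keys y"
    have ext: "(\<Sum>k\<in>Poly_Mapping.keys z. Poly_Mapping.lookup z k * \<phi> k i)
       = (\<Sum>k\<in>?S. Poly_Mapping.lookup z k * \<phi> k i)" if "Poly_Mapping.keys z \<subseteq> ?S" for z
      using that by (intro sum.mono_neutral_left) (auto simp: in_keys_iff)
    have "h (x - y) = h x \<otimes>\<^bsub>H\<^esub> inv\<^bsub>H\<^esub> h y"
      using h.hom_mult[of x "-y"] h.hom_inv[of y] xy by simp
    then have "\<phi> (h (x - y)) i = \<phi> (h x) i - \<phi> (h y) i"
      using xy h.hom_closed[of x] h.hom_closed[of y] by (simp add: add pinv)
    then show "\<phi> (h (x - y)) i
        = (\<Sum>k\<in>Poly_Mapping.keys (x - y). Poly_Mapping.lookup (x - y) k * \<phi> k i)"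
      using ext[of x] ext[of y] ext[OF keys_diff]
      by (simp add: IH lookup_minus sum_subtractf left_diff_distrib)
  next
    fix a assume "a \<in> b ` J"
    then show "\<phi> (h (frag_of a)) i
        = (\<Sum>k\<in>Poly_Mapping.keys (frag_of a). Poly_Mapping.lookup (frag_of a) k * \<phi> k i)"
      using hb by simp
  qed
  have "inj_on h (carrier ?F)"
    unfolding h.inj_on_one_iff
  proof (intro allI impI)
    fix c assume c: "c \<in> carrier ?F" and one: "h c = \<one>\<^bsub>H\<^esub>"
    let ?I = "{i \<in> J. b i \<in> Poly_Mapping.keys c}"
    show "c = \<one>\<^bsub>?F\<^esub>"
    proof (rule ccontr)
      assume "c \<noteq> \<one>\<^bsub>?F\<^esub>"
      then have "Poly_Mapping.keys c \<noteq> {}" by simp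
      then obtain k where "k \<in> Poly_Mapping.keys c" by blast
      then have "?I \<noteq> {}" using c by auto
      moreover have "finite ?I"
        using finite_vimage_IntI[OF finite_keys binj, of c] by (simp add: vimage_def Int_def conj_commute)
      ultimately obtain i where i: "i \<in> ?I" "\<forall>j\<in>?I. (j, i) \<in> r"
        using finite_total_order_max[OF _ _ subset_UNIV lin] by blast
      have "\<phi> k i = 0" if k: "k \<in> Poly_Mapping.keys c" "k \<noteq> b i" for k
      proof -
        obtain j where j: "j \<in> J" "k = b j" using k(1) c by auto
        then have ji: "(j, i) \<in> r" "j \<noteq> i" using i k by auto
        show ?thesis
          using b[OF j(1)] ji asym unfolding K_def j(2) by blast
      qed
      then have "\<phi> (h c) i = Poly_Mapping.lookup c (b i) * \<phi> (b i) i"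
        using c i(1) by (simp add: eval sum.remove[of _ "b i"])
      moreover have "\<dots> \<noteq> 0" using i b[of i] by (auto simp: in_keys_iff)
      ultimately show False using one pone by simp
    qed
  qed
  then have "h \<in> iso ?F H"
    using h surj h.hom_closed by (auto simp: iso_def bij_betw_def)
  then have "H \<cong> ?F"
    using group.iso_sym[OF group_free_Abelian_group] by (auto simp: is_iso_def)
  then show ?thesis unfolding free_abelian_def by blast
qed

section \<open>Square presentations and reduced words\<close>

text \<open>
  The edges of a nonpositively curved cube complex whose walls are two-sided, with the vertices
  forgotten. The relation \<open>ind e f\<close> says that \<open>e\<close> and \<open>f\<close> start at the same vertex and span a
  square, and \<open>res e f\<close> is the edge opposite to \<open>e\<close> in it, which starts where \<open>f\<close> ends. The
  axioms on \<open>bar\<close> describe the same square from its other corners, the axioms \<open>cube_ind\<close> and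
  \<open>cube_res\<close> say that three edges which span squares in pairs span a cube, and \<open>pos\<close> orients the
  walls.

  Forgetting the vertices turns the fundamental groupoid into a group, given by the generators
  \<open>E\<close> with the relations \<open>e bar e = 1\<close> and \<open>a (res b a) = b (res a b)\<close>, and words need not be
  paths.
\<close>
locale square_presentation =
  fixes E :: "'e set" and bar :: "'e \<Rightarrow> 'e" and ind :: "'e \<Rightarrow> 'e \<Rightarrow> bool"
    and res :: "'e \<Rightarrow> 'e \<Rightarrow> 'e" and pos :: "'e \<Rightarrow> bool"
  assumes bar_bar [simp]: "bar (bar e) = e"
    and bar_E: "e \<in> E \<Longrightarrow> bar e \<in> E"
    and pos_bar: "e \<in> E \<Longrightarrow> pos (bar e) \<longleftrightarrow> \<not> pos e"
    and ind_E: "ind e f \<Longrightarrow> e \<in> E"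
    and ind_sym: "ind e f \<Longrightarrow> ind f e"
    and ind_irrefl [simp]: "\<not> ind e e"
    and ind_bar: "ind e f \<Longrightarrow> ind (bar e) (res f e)"
    and res_E: "ind e f \<Longrightarrow> res e f \<in> E"
    and pos_res: "ind e f \<Longrightarrow> pos (res e f) \<longleftrightarrow> pos e"
    and res_res_bar: "ind e f \<Longrightarrow> res (res f e) (bar e) = f"
    and res_bar: "ind e f \<Longrightarrow> res (bar e) (res f e) = bar (res e f)"
    and cube_ind: "ind e f \<Longrightarrow> ind e h \<Longrightarrow> ind f h \<Longrightarrow> ind (res e h) (res f h)"
    and cube_res: "ind e f \<Longrightarrow> ind e h \<Longrightarrow> ind f h \<Longrightarrow>
      res (res e h) (res f h) = res (res e f) (res h f)"
begin

lemma E_bar_iff [simp]: "bar e \<in> E \<longleftrightarrow> e \<in> E"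
  using bar_E[of e] bar_E[of "bar e"] by auto

lemma ind_bar_res: "ind e f \<Longrightarrow> ind (res e f) (bar f)"
  by (meson ind_bar ind_sym)

lemma ind_opposite: "ind e f \<Longrightarrow> ind (bar (res e f)) (bar (res f e))"
  using ind_bar[OF ind_bar_res, of e f] res_bar ind_sym res_bar[of f e] ind_bar_res
  by (metis bar_bar ind_bar)

text \<open>
  The cube condition read from the corner where \<open>h\<close> ends.
\<close>
lemma cube_ind_conv:
  assumes "ind e h" "ind f h" "ind (res e h) (res f h)"
  shows "ind e f"
  using cube_ind[OF assms(3) ind_bar_res[OF assms(1)] ind_bar_res[OF assms(2)]] assms(1,2)
  by (simp add: res_res_bar ind_sym)

lemma res_inj: "ind e h \<Longrightarrow> ind f h \<Longrightarrow> res e h = res f h \<Longrightarrow> e = f"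
  by (metis ind_sym res_res_bar)

inductive swap :: "'e list \<Rightarrow> 'e list \<Rightarrow> bool" where
  here: "ind a b \<Longrightarrow> swap (a # res b a # s) (b # res a b # s)"
| later: "swap s t \<Longrightarrow> swap (x # s) (x # t)"

lemma swap_sym: "swap s t \<Longrightarrow> swap t s"
  by (induction rule: swap.induct) (auto intro: swap.intros ind_sym)

lemma swap_length: "swap s t \<Longrightarrow> length s = length t"
  by (induction rule: swap.induct) auto

abbreviation swaps where "swaps \<equiv> swap\<^sup>*\<^sup>*"

lemma swaps_sym: "swaps s t \<Longrightarrow> swaps t s"
  by (metis swap_sym symp_rtranclp sympI sympD)

lemma swaps_length: "swaps s t \<Longrightarrow> length s = length t"
  by (induction rule: rtranclp_induct) (auto dest: swap_length)

lemma swaps_Cons: "swaps s t \<Longrightarrow> swaps (x # s) (x # t)"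
  by (induction rule: rtranclp_induct) (auto intro: rtranclp.rtrancl_into_rtrancl swap.later)

lemma swaps_here: "ind a b \<Longrightarrow> swaps (a # res b a # s) (b # res a b # s)"
  by (blast intro: swap.here)

text \<open>
  Pushes an occurrence of \<open>g\<close> to the front of a word across squares, and removes it. It follows
  the edge \<open>g\<close> along the word as long as it stays independent of the letters it meets, so the
  occurrence found is unique.
\<close>
fun pull :: "'e \<Rightarrow> 'e list \<Rightarrow> 'e list option" where
  "pull g [] = None"
| "pull g (h # s) =
     (if h = g then Some s
      else if ind g h then map_option ((#) (res h g)) (pull (res g h) s)
      else None)"

text \<open>
  Pushing \<open>g\<close> past a pair of letters and past the swapped pair gives opposite faces of a cube.
\<close>
lemma pull_swap:
  assumes "swap s t" "pull g s = Some s'"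
  shows "\<exists>t'. pull g t = Some t' \<and> swaps s' t'"
  using assms
proof (induction arbitrary: g s' rule: swap.induct)
  case (here a b s)
  have ba: "ind b a" and ne: "a \<noteq> b" using here(1) by (auto dest: ind_sym)
  consider "g = a" | "g = b" | "g \<noteq> a" "g \<noteq> b" by blast
  then show ?case
  proof cases
    case 1
    then show ?thesis using here ne by auto
  next
    case 2
    then show ?thesis using here ne ba by auto
  next
    case 3
    then have ga: "ind g a" using here(2) by (auto split: if_splits)
    have n1: "res b a \<noteq> res g a" using res_inj[OF ba ga] 3 by auto
    then have iga: "ind (res g a) (res b a)" using here(2) 3 by (auto split: if_splits)
    then have gb: "ind g b" using cube_ind_conv[OF ga ba] by simp
    have n2: "res a b \<noteq> res g b" using res_inj[OF here(1) gb] 3 by auto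
    have igb: "ind (res g b) (res a b)" by (rule cube_ind[OF ga gb here(1)])
    have c: "res (res g b) (res a b) = res (res g a) (res b a)"
      by (rule cube_res[OF ga gb here(1)])
    obtain u where u: "pull (res (res g a) (res b a)) s = Some u"
      and s': "s' = res a g # res (res b a) (res g a) # u"
      using here(2) 3 n1 iga ga by auto
    have ag: "ind (res a g) (res b g)"
      using cube_ind[OF here(1) ind_sym[OF ga] ind_sym[OF gb]] .
    have e1: "res (res b a) (res g a) = res (res b g) (res a g)"
      using cube_res[OF ind_sym[OF gb] ba ga] by simp
    have e2: "res (res a b) (res g b) = res (res a g) (res b g)"
      using cube_res[OF ind_sym[OF ga] here(1) gb] by simp
    have "pull g (b # res a b # s) = Some (res b g # res (res a b) (res g b) # u)"
      using 3 gb n2 igb c u by simp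
    then show ?thesis
      unfolding s' e1 e2 using swaps_here[OF ag] by auto
  qed
next
  case (later s t x)
  then show ?case
    by (fastforce split: if_splits intro: swaps_Cons)
qed

lemma pull_swaps:
  assumes "swaps s t" "pull g s = Some s'"
  shows "\<exists>t'. pull g t = Some t' \<and> swaps s' t'"
  using assms
  by (induction rule: rtranclp_induct) (auto dest!: pull_swap intro: rtranclp_trans)

lemma pull_swaps_None: "swaps s t \<Longrightarrow> pull g s = None \<longleftrightarrow> pull g t = None"
  using pull_swaps[of s t g] pull_swaps[OF swaps_sym, of s t g]
  by (cases "pull g s"; cases "pull g t") auto

lemma pull_imp_swaps: "pull g s = Some t \<Longrightarrow> swaps s (g # t)"
proof (induction s arbitrary: g t)
  case (Cons h s)
  show ?case
  proof (cases "h = g")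
    case False
    then obtain u where gh: "ind g h" and u: "pull (res g h) s = Some u" "t = res h g # u"
      using Cons.prems by (auto split: if_splits)
    have "swaps (h # s) (h # res g h # u)" using Cons.IH[OF u(1)] by (rule swaps_Cons)
    then show ?thesis
      using swaps_here[OF ind_sym[OF gh]] u(2) by (auto intro: rtranclp_trans)
  qed (use Cons in auto)
qed simp

text \<open>
  No letter can be cancelled against its inverse, even after swaps.
\<close>
fun reduced :: "'e list \<Rightarrow> bool" where
  "reduced [] \<longleftrightarrow> True"
| "reduced (h # s) \<longleftrightarrow> pull (bar h) s = None \<and> reduced s"

lemma pull_bar_res:
  assumes "ind a b"
  shows "pull (bar a) (res b a # s) = map_option ((#) b) (pull (bar (res a b)) s)"
proof -
  have i: "ind (bar a) (res b a)" using assms by (rule ind_bar)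
  then have "res b a \<noteq> bar a" by auto
  then show ?thesis using i assms by (simp add: res_bar res_res_bar)
qed

lemma reduced_swap: "swap s t \<Longrightarrow> reduced s \<Longrightarrow> reduced t"
proof (induction rule: swap.induct)
  case (here a b s)
  then show ?case using ind_sym[OF here(1)] by (auto simp: pull_bar_res simp del: pull.simps)
next
  case (later s t x)
  then show ?case using pull_swaps_None[OF r_into_rtranclp[where r=swap], of s t "bar x"] by auto
qed

lemma reduced_swaps: "swaps s t \<Longrightarrow> reduced s \<Longrightarrow> reduced t"
  by (induction rule: rtranclp_induct) (auto intro: reduced_swap)

lemma reduced_append: "reduced (s @ t) \<Longrightarrow> reduced t"
  by (induction s) auto

text \<open>
  Multiplication of a reduced word by a letter on the left. Letting the letters act on reduced
  words, and checking the defining relations, avoids an analysis of how several cancellations in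
  one word interact.
\<close>
definition lmul :: "'e \<Rightarrow> 'e list \<Rightarrow> 'e list" where
  "lmul f s = (case pull (bar f) s of None \<Rightarrow> f # s | Some t \<Rightarrow> t)"

lemma lmul_swaps: "swaps s t \<Longrightarrow> swaps (lmul f s) (lmul f t)"
  using pull_swaps[of s t "bar f"] pull_swaps_None[of s t "bar f"]
  by (auto simp: lmul_def swaps_Cons split: option.splits)

lemma reduced_lmul: "reduced s \<Longrightarrow> reduced (lmul f s)"
  by (auto simp: lmul_def split: option.splits dest!: pull_imp_swaps dest: reduced_swaps)

lemma lmul_bar:
  assumes "reduced s" shows "swaps (lmul f (lmul (bar f) s)) s"
proof (cases "pull f s")
  case None
  then show ?thesis by (simp add: lmul_def)
next
  case (Some t)
  then have "swaps s (f # t)" by (rule pull_imp_swaps)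
  moreover from this have "pull (bar f) t = None" using assms reduced_swaps by fastforce
  ultimately show ?thesis using Some by (simp add: lmul_def swaps_sym)
qed

text \<open>
  If one of the two letters cancels then, after swaps, the word starts with its inverse, and
  both sides can be computed; if neither does, both sides are the word with the two sides of the
  square in front.
\<close>
lemma lmul_square:
  assumes ab: "ind a b" and s: "reduced s"
  shows "swaps (lmul a (lmul (res b a) s)) (lmul b (lmul (res a b) s))"
proof -
  have *: "swaps (lmul a (lmul (res b a) s)) (lmul b (lmul (res a b) s))"
    if ab: "ind a b" and t: "pull (bar (res b a)) s = Some t" for a b t
  proof -
    let ?a = "res a b" and ?b = "res b a"
    have ba: "ind b a" using ab by (rule ind_sym)
    have s: "swaps s (bar ?b # t)" using t by (rule pull_imp_swaps)
    have o: "ind (bar ?a) (bar ?b)" by (rule ind_opposite[OF ab])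
    have r: "res (bar ?a) (bar ?b) = bar a"
      using res_bar[OF ind_bar_res[OF ba]] res_res_bar[OF ab]
      by (metis ab bar_bar ba ind_bar_res ind_sym res_bar res_res_bar)
    have r': "res (bar ?b) (bar ?a) = bar b"
      by (metis ab bar_bar ba ind_bar_res ind_sym res_bar res_res_bar)
    have ne: "bar ?b \<noteq> bar ?a" using o by auto
    have x: "pull (bar ?a) (bar ?b # t) = map_option ((#) (bar b)) (pull (bar a) t)"
      using o ne r r' by simp
    have L: "lmul a (lmul ?b s) = lmul a t" using t by (simp add: lmul_def)
    have R: "swaps (lmul b (lmul ?a s)) (lmul b (lmul ?a (bar ?b # t)))"
      using s by (intro lmul_swaps)
    have "lmul b (lmul ?a (bar ?b # t)) = lmul a t"
    proof (cases "pull (bar a) t")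
      case (Some u)
      then show ?thesis using x by (simp add: lmul_def)
    next
      case None
      then have "lmul ?a (bar ?b # t) = ?a # bar ?b # t" using x by (simp add: lmul_def)
      moreover have "pull (bar b) (?a # bar ?b # t) = Some (a # t)"
        using pull_bar_res[OF ba] by simp
      ultimately show ?thesis using None by (simp add: lmul_def)
    qed
    then show ?thesis using L R swaps_sym by metis
  qed
  have ba: "ind b a" using ab by (rule ind_sym)
  show ?thesis
  proof (cases "pull (bar (res b a)) s")
    case (Some t) then show ?thesis using *[OF ab] by blast
  next
    case b: None
    show ?thesis
    proof (cases "pull (bar (res a b)) s")
      case (Some t) then show ?thesis using *[OF ba] swaps_sym by blast
    next
      case None
      then show ?thesis
        using b pull_bar_res[OF ab, of s] pull_bar_res[OF ba, of s] swaps_here[OF ab]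
        by (simp add: lmul_def del: pull.simps)
    qed
  qed
qed

inductive eqv :: "'e list \<Rightarrow> 'e list \<Rightarrow> bool" (infix "\<doteq>" 50) where
  eqv_refl [simp, intro]: "p \<doteq> p"
| eqv_sym: "p \<doteq> q \<Longrightarrow> q \<doteq> p"
| eqv_trans [trans]: "p \<doteq> q \<Longrightarrow> q \<doteq> r \<Longrightarrow> p \<doteq> r"
| eqv_context: "p \<doteq> q \<Longrightarrow> u @ p @ v \<doteq> u @ q @ v"
| eqv_cancel: "e \<in> E \<Longrightarrow> [e, bar e] \<doteq> []"
| eqv_square: "ind a b \<Longrightarrow> [a, res b a] \<doteq> [b, res a b]"

abbreviation act :: "'e list \<Rightarrow> 'e list \<Rightarrow> 'e list" where "act \<equiv> foldr lmul"

definition nf :: "'e list \<Rightarrow> 'e list" where "nf p = act p []"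

lemma act_swaps: "swaps s t \<Longrightarrow> swaps (act p s) (act p t)"
  by (induction p) (auto intro: lmul_swaps)

lemma reduced_act: "reduced s \<Longrightarrow> reduced (act p s)"
  by (induction p) (auto intro: reduced_lmul)

text \<open>
  The normal form theorem: equal words have the same action on reduced words up to swaps.
  Applied to the empty word, it says that equal reduced words differ only by swaps.
\<close>
lemma act_eqv: "p \<doteq> q \<Longrightarrow> reduced s \<Longrightarrow> swaps (act p s) (act q s)"
proof (induction arbitrary: s rule: eqv.induct)
  case (eqv_sym p q) then show ?case by (blast intro: swaps_sym)
next
  case (eqv_trans p q r) then show ?case by (blast intro: rtranclp_trans)
next
  case (eqv_context p q u v) then show ?case by (auto intro!: act_swaps reduced_act)
next
  case (eqv_cancel e) then show ?case using lmul_bar by simp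
next
  case (eqv_square a b) then show ?case using lmul_square by simp
qed simp

lemma reduced_nf: "reduced (nf p)" by (simp add: nf_def reduced_act)

lemma nf_eqv: "p \<doteq> q \<Longrightarrow> swaps (nf p) (nf q)" by (simp add: nf_def act_eqv)

lemma nf_Cons: "nf (e # p) = lmul e (nf p)" by (simp add: nf_def)

lemma nf_reduced: "reduced p \<Longrightarrow> nf p = p"
  by (induction p) (auto simp: nf_def lmul_def)

section \<open>Calculations in the group\<close>

lemma eqv_commute: "p \<doteq> q \<longleftrightarrow> q \<doteq> p"
  by (rule iffI; erule eqv_sym)

lemma eqv_append: "p \<doteq> p' \<Longrightarrow> q \<doteq> q' \<Longrightarrow> p @ q \<doteq> p' @ q'"
  using eqv_trans[of "p @ q" "p' @ q"] eqv_context[of p p' "[]" q] eqv_context[of q q' p' "[]"]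
  by simp

lemma eqv_append_left: "q \<doteq> q' \<Longrightarrow> p @ q \<doteq> p @ q'"
  by (rule eqv_append) auto

lemma eqv_append_right: "p \<doteq> p' \<Longrightarrow> p @ q \<doteq> p' @ q"
  by (rule eqv_append) auto

lemma eqv_Cons: "q \<doteq> q' \<Longrightarrow> x # q \<doteq> x # q'"
  using eqv_append_left[of q q' "[x]"] by simp

lemma swap_eqv: "swap s t \<Longrightarrow> s \<doteq> t"
proof (induction rule: swap.induct)
  case (here a b s)
  then show ?case using eqv_context[OF eqv_square, of a b "[]" s] by simp
qed (rule eqv_Cons)

lemma swaps_eqv: "swaps s t \<Longrightarrow> s \<doteq> t"
  by (induction rule: rtranclp_induct) (simp, erule eqv_trans, erule swap_eqv)

lemma eqv_cancel_context: "e \<in> E \<Longrightarrow> p @ e # bar e # q \<doteq> p @ q"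
  using eqv_context[OF eqv_cancel, of e p q] by simp

lemma lmul_eqv: assumes "f \<in> E" shows "lmul f s \<doteq> f # s"
proof (cases "pull (bar f) s")
  case (Some t)
  then have "f # s \<doteq> f # bar f # t" by (intro eqv_Cons swaps_eqv pull_imp_swaps)
  also have "\<dots> \<doteq> t" using eqv_cancel_context[OF assms, of "[]" t] by simp
  finally show ?thesis using Some by (simp add: lmul_def eqv_commute)
qed (simp add: lmul_def)

lemma nf_eqv_self: "p \<in> lists E \<Longrightarrow> nf p \<doteq> p"
proof (induction p)
  case (Cons e p)
  then have "nf (e # p) \<doteq> e # nf p" by (simp add: nf_Cons lmul_eqv)
  also have "\<dots> \<doteq> e # p" using Cons by (intro eqv_Cons) auto
  finally show ?case .
qed (simp add: nf_def)

lemma pull_lists: "pull g s = Some t \<Longrightarrow> s \<in> lists E \<Longrightarrow> t \<in> lists E"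
proof (induction s arbitrary: g t)
  case (Cons h s)
  show ?case
  proof (cases "h = g")
    case False
    then obtain u where "ind g h" "pull (res g h) s = Some u" "t = res h g # u"
      using Cons.prems by (auto split: if_splits)
    then show ?thesis using Cons.IH Cons.prems by (simp add: res_E ind_sym)
  qed (use Cons.prems in simp)
qed simp

lemma nf_lists: "p \<in> lists E \<Longrightarrow> nf p \<in> lists E"
  by (induction p) (auto simp: nf_Cons nf_def[of "[]"] lmul_def split: option.splits dest: pull_lists)

definition rinv :: "'e list \<Rightarrow> 'e list" where "rinv p = rev (map bar p)"

lemma rinv_simps [simp]: "rinv [] = []" "rinv (e # p) = rinv p @ [bar e]"
  "rinv (p @ q) = rinv q @ rinv p" "length (rinv p) = length p"
  by (auto simp: rinv_def)

lemma rinv_rinv [simp]: "rinv (rinv p) = p"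
  by (induction p) auto

lemma rinv_lists [simp]: "rinv p \<in> lists E \<longleftrightarrow> p \<in> lists E"
  by (auto simp: rinv_def in_lists_conv_set)

lemma rinv_right: "p \<in> lists E \<Longrightarrow> p @ rinv p \<doteq> []"
proof (induction p)
  case (Cons e p)
  then have "[e] @ (p @ rinv p) @ [bar e] \<doteq> [e] @ [] @ [bar e]"
    by (intro eqv_context) auto
  also have "\<dots> \<doteq> []" using Cons eqv_cancel by simp
  finally show ?case by simp
qed simp

lemma rinv_left: "p \<in> lists E \<Longrightarrow> rinv p @ p \<doteq> []"
  using rinv_right[of "rinv p"] by simp

lemma cancel_right: "q \<in> lists E \<Longrightarrow> p @ q @ rinv q @ r \<doteq> p @ r"
  using eqv_context[OF rinv_right, of q p r] by simp

lemma cancel_left: "q \<in> lists E \<Longrightarrow> p @ rinv q @ q @ r \<doteq> p @ r"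
  using cancel_right[of "rinv q" p r] by simp

lemma eqv_left_cancel:
  assumes "u \<in> lists E" "u @ p \<doteq> u @ q" shows "p \<doteq> q"
proof -
  have "p \<doteq> rinv u @ u @ p" using cancel_left[OF assms(1), of "[]" p] by (simp add: eqv_commute)
  also have "\<dots> \<doteq> rinv u @ u @ q" using assms(2) by (rule eqv_append_left)
  also have "\<dots> \<doteq> q" using cancel_left[OF assms(1), of "[]" q] by simp
  finally show ?thesis .
qed

lemma eqv_right_cancel:
  assumes "u \<in> lists E" "p @ u \<doteq> q @ u" shows "p \<doteq> q"
proof -
  have "p \<doteq> (p @ u) @ rinv u" using cancel_right[OF assms(1), of p "[]"] by (simp add: eqv_commute)
  also have "\<dots> \<doteq> (q @ u) @ rinv u" using assms(2) by (rule eqv_append_right)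
  also have "\<dots> \<doteq> q" using cancel_right[OF assms(1), of q "[]"] by simp
  finally show ?thesis .
qed

lemma rinv_eqv:
  assumes "p \<doteq> q" "p \<in> lists E" "q \<in> lists E" shows "rinv p \<doteq> rinv q"
proof (rule eqv_right_cancel[OF assms(3)])
  have "rinv p @ q \<doteq> rinv p @ p" by (rule eqv_append_left[OF eqv_sym[OF assms(1)]])
  also have "\<dots> \<doteq> []" by (rule rinv_left[OF assms(2)])
  also have "\<dots> \<doteq> rinv q @ q" by (rule eqv_sym[OF rinv_left[OF assms(3)]])
  finally show "rinv p @ q \<doteq> rinv q @ q" .
qed

section \<open>Word length\<close>

definition wlen :: "'e list \<Rightarrow> nat" where "wlen p = length (nf p)"

lemma wlen_eqv: "p \<doteq> q \<Longrightarrow> wlen p = wlen q"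
  by (simp add: wlen_def nf_eqv swaps_length)

lemma pull_length: "pull g s = Some t \<Longrightarrow> length s = Suc (length t)"
  by (drule pull_imp_swaps, drule swaps_length) simp

lemma lmul_length: "length (lmul f s) = (if pull (bar f) s = None then Suc (length s) else length s - 1)"
  by (auto simp: lmul_def split: option.splits dest: pull_length)

lemma wlen_Cons: "wlen (f # s) = (if pull (bar f) (nf s) = None then Suc (wlen s) else wlen s - 1)"
  by (simp add: wlen_def nf_Cons lmul_length)

lemma wlen_Nil [simp]: "wlen [] = 0" by (simp add: wlen_def nf_def)

lemma wlen_le_length: "wlen p \<le> length p"
  by (induction p) (auto simp: wlen_Cons)

lemma wlen_append_le_left: "wlen (p @ q) \<le> length p + wlen q"
  by (induction p) (auto simp: wlen_Cons)

lemma wlen_reduced: "reduced p \<Longrightarrow> wlen p = length p"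
  by (simp add: wlen_def nf_reduced)

lemma reduced_iff_wlen: "reduced p \<longleftrightarrow> wlen p = length p"
proof
  show "wlen p = length p \<Longrightarrow> reduced p"
  proof (induction p)
    case (Cons f p)
    have "wlen p \<le> length p" by (rule wlen_le_length)
    then have "pull (bar f) (nf p) = None" "wlen p = length p"
      using Cons.prems by (auto simp: wlen_Cons split: if_splits)
    then show ?case using Cons.IH by (simp add: nf_reduced)
  qed simp
qed (rule wlen_reduced)

lemma wlen_rinv: assumes "p \<in> lists E" shows "wlen (rinv p) = wlen p"
proof -
  have le: "wlen (rinv p) \<le> wlen p" if "p \<in> lists E" for p
  proof -
    have "wlen (rinv p) = wlen (rinv (nf p))"
      using that by (intro wlen_eqv rinv_eqv eqv_sym[OF nf_eqv_self] nf_lists)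
    then show ?thesis using wlen_le_length[of "rinv (nf p)"] by (simp add: wlen_def)
  qed
  show ?thesis using le[OF assms] le[of "rinv p"] assms by simp
qed

lemma wlen_append_le_right: assumes "p \<in> lists E" "q \<in> lists E"
  shows "wlen (p @ q) \<le> wlen p + length q"
  using wlen_append_le_left[of "rinv q" "rinv p"] wlen_rinv[of "p @ q"] wlen_rinv[OF assms(1)] assms
  by simp

lemma wlen_append_le: assumes "p \<in> lists E" "q \<in> lists E"
  shows "wlen (p @ q) \<le> wlen p + wlen q"
proof -
  have "wlen (p @ q) = wlen (p @ nf q)"
    using assms by (intro wlen_eqv eqv_append_left eqv_sym[OF nf_eqv_self])
  also have "\<dots> \<le> wlen p + length (nf q)" using assms by (intro wlen_append_le_right nf_lists)
  finally show ?thesis by (simp add: wlen_def)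
qed

section \<open>Transport of edges along walls\<close>

text \<open>
  The edge \<open>g\<close> can be pushed across squares along all of the word; \<open>carry\<close> is the edge at which
  it ends up, and \<open>shift\<close> is the opposite side of the strip of squares.
\<close>
fun avoids :: "'e \<Rightarrow> 'e list \<Rightarrow> bool" where
  "avoids g [] \<longleftrightarrow> True"
| "avoids g (h # s) \<longleftrightarrow> ind g h \<and> avoids (res g h) s"

fun carry :: "'e \<Rightarrow> 'e list \<Rightarrow> 'e" where
  "carry g [] = g"
| "carry g (h # s) = carry (res g h) s"

fun shift :: "'e \<Rightarrow> 'e list \<Rightarrow> 'e list" where
  "shift g [] = []"
| "shift g (h # s) = res h g # shift (res g h) s"

lemma avoids_append: "avoids g (s @ t) \<longleftrightarrow> avoids g s \<and> avoids (carry g s) t"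
  by (induction s arbitrary: g) auto

lemma carry_append: "carry g (s @ t) = carry (carry g s) t"
  by (induction s arbitrary: g) auto

lemma length_shift [simp]: "length (shift g s) = length s"
  by (induction s arbitrary: g) auto

lemma avoids_lists: "avoids g s \<Longrightarrow> s \<in> lists E"
  by (induction s arbitrary: g) (auto dest: ind_sym ind_E)

lemma shift_lists: "avoids g s \<Longrightarrow> shift g s \<in> lists E"
  by (induction s arbitrary: g) (auto dest: ind_sym intro: res_E)

lemma carry_E: "avoids g s \<Longrightarrow> g \<in> E \<Longrightarrow> carry g s \<in> E"
  by (induction s arbitrary: g) (auto intro: res_E)

lemma pos_carry: "avoids g s \<Longrightarrow> pos (carry g s) \<longleftrightarrow> pos g"
  by (induction s arbitrary: g) (auto simp: pos_res)

lemma carry_eqv: "avoids g s \<Longrightarrow> s @ [carry g s] \<doteq> g # shift g s"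
proof (induction s arbitrary: g)
  case (Cons h s)
  then have "h # s @ [carry (res g h) s] \<doteq> h # res g h # shift (res g h) s"
    by (intro eqv_Cons) auto
  also have "\<dots> \<doteq> g # res h g # shift (res g h) s"
    using Cons by (intro swaps_eqv swaps_here) (auto intro: ind_sym)
  finally show ?case by simp
qed simp

lemma avoids_shift:
  "avoids g s \<Longrightarrow> avoids (bar g) (shift g s) \<and> carry (bar g) (shift g s) = bar (carry g s)"
proof (induction s arbitrary: g)
  case (Cons h s)
  then show ?case by (auto simp: ind_bar res_bar)
qed simp

lemma avoids_rinv:
  "avoids g s \<Longrightarrow> avoids (carry g s) (rinv s) \<and> carry (carry g s) (rinv s) = g"
proof (induction s arbitrary: g)
  case (Cons h s)
  then show ?case
    by (auto simp: avoids_append carry_append ind_bar_res res_res_bar ind_sym)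
qed simp

lemma pull_append:
  assumes "pull g (s @ t) = Some u" "pull g s = None"
  shows "avoids g s \<and> pull (carry g s) t \<noteq> None"
  using assms
  by (induction s arbitrary: g u) (auto split: if_splits)

text \<open>
  Transport along a word survives the cancellation of a letter: the strip along the word and the
  square on the cancelled letter form cubes.
\<close>
lemma avoids_pull:
  assumes "pull k s = Some t" "avoids g s" "ind g k"
  shows "avoids (res g k) t \<and> carry (res g k) t = carry g s"
  using assms
proof (induction s arbitrary: k t g)
  case (Cons x s)
  show ?case
  proof (cases "x = k")
    case False
    then obtain u where kx: "ind k x" and u: "pull (res k x) s = Some u" "t = res x k # u"
      using Cons.prems(1) by (auto split: if_splits)
    have gx: "ind g x" using Cons.prems(2) by simp
    note gk = Cons.prems(3)
    have "avoids (res (res g x) (res k x)) u \<and> carry (res (res g x) (res k x)) u = carry (res g x) s"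
      using Cons.IH[OF u(1)] Cons.prems(2) cube_ind[OF gk gx kx] by simp
    then show ?thesis
      using cube_res[OF gk gx kx] cube_ind[OF gx gk ind_sym[OF kx]] u(2) by simp
  qed (use Cons.prems in auto)
qed simp

lemma avoids_nf: "avoids g s \<Longrightarrow> avoids g (nf s) \<and> carry g (nf s) = carry g s"
proof (induction s arbitrary: g)
  case (Cons h s)
  then have gh: "ind g h" and IH: "avoids (res g h) (nf s)" "carry (res g h) (nf s) = carry g (h # s)"
    by auto
  show ?case
  proof (cases "pull (bar h) (nf s)")
    case None
    then show ?thesis using gh IH by (simp add: nf_Cons lmul_def)
  next
    case (Some t)
    have "res (res g h) (bar h) = g" using gh by (simp add: res_res_bar ind_sym)
    then show ?thesis
      using avoids_pull[OF Some IH(1) ind_bar_res[OF gh]] IH(2) Some by (simp add: nf_Cons lmul_def)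
  qed
qed (simp add: nf_def)

text \<open>
  A geodesic does not cross a wall and then cross it back. By \<open>avoids_nf\<close> the strip between the
  two crossings may be taken along a shortest word. The other side of the strip has the same
  length, and is a shortcut.
\<close>
lemma no_recrossing:
  assumes "reduced (e # r @ [f])" "e \<in> E" "avoids (bar e) d" "carry (bar e) d = f" "d \<doteq> r"
  shows False
proof -
  let ?d = "nf d"
  have d: "avoids (bar e) ?d" "carry (bar e) ?d = f" using avoids_nf[OF assms(3)] assms(4) by auto
  have "?d \<doteq> r" using nf_eqv_self[OF avoids_lists[OF assms(3)]] assms(5) by (rule eqv_trans)
  then have "e # r @ [f] \<doteq> e # ?d @ [f]"
    using eqv_context[OF eqv_sym[OF \<open>?d \<doteq> r\<close>], of "[e]" "[f]"] by simp
  also have "\<dots> \<doteq> e # bar e # shift (bar e) ?d"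
    using carry_eqv[OF d(1)] d(2) by (intro eqv_Cons) simp
  also have "\<dots> \<doteq> shift (bar e) ?d"
    using eqv_cancel_context[OF assms(2), of "[]"] by simp
  finally have "wlen (e # r @ [f]) \<le> length (shift (bar e) ?d)"
    using wlen_eqv wlen_le_length by metis
  also have "\<dots> = wlen r" using wlen_eqv[OF assms(5)] by (simp add: wlen_def)
  also have "\<dots> \<le> length r" by (rule wlen_le_length)
  finally show False using assms(1) by (simp add: wlen_reduced del: reduced.simps)
qed

text \<open>
  Let \<open>r = k s\<close> and suppose that \<open>s k\<close> is reduced although \<open>k s k\<close> is not. Then the first letter
  of \<open>k s k\<close> cancels against the last one, so \<open>bar k\<close> is parallel to \<open>k\<close>, against the
  orientation of the walls.
\<close>
lemma dichotomy:
  assumes r: "reduced r" "pull k r \<noteq> None" and k: "k \<in> E" and l: "wlen (r @ [k]) < length r"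
  shows "wlen (bar k # r @ [k]) < length r"
proof -
  obtain s where s: "swaps r (k # s)" using r(2) pull_imp_swaps by blast
  have red: "reduced (k # s)" by (rule reduced_swaps[OF s r(1)])
  have len: "length r = Suc (length s)" using swaps_length[OF s] by simp
  have "bar k # r @ [k] \<doteq> bar k # k # s @ [k]"
    using eqv_context[OF swaps_eqv[OF s], of "[bar k]" "[k]"] by simp
  also have "\<dots> \<doteq> s @ [k]" using eqv_cancel_context[of "bar k" "[]"] k by simp
  finally have e: "wlen (bar k # r @ [k]) = wlen (s @ [k])" by (rule wlen_eqv)
  have "wlen (s @ [k]) \<noteq> length (s @ [k])"
  proof
    assume "wlen (s @ [k]) = length (s @ [k])"
    then have red2: "reduced (s @ [k])" by (simp add: reduced_iff_wlen)
    have "wlen (k # s @ [k]) = wlen (r @ [k])"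
      using eqv_append_right[OF swaps_eqv[OF s], of "[k]"] by (simp add: wlen_eqv)
    then have "pull (bar k) (s @ [k]) \<noteq> None"
      using l len red2 by (auto simp: wlen_Cons nf_reduced wlen_reduced split: if_splits)
    moreover have "pull (bar k) s = None" using red by simp
    ultimately have "avoids (bar k) s" "pull (carry (bar k) s) [k] \<noteq> None"
      using pull_append by blast+
    then have "carry (bar k) s = k" by (auto split: if_splits)
    then show False using pos_carry[OF \<open>avoids (bar k) s\<close>] pos_bar[OF k] by simp
  qed
  then show ?thesis using e len wlen_le_length[of "s @ [k]"] by simp
qed

lemma first_cancellation:
  assumes "reduced r" "\<not> reduced (p @ r)"
  obtains p1 g s where "p = p1 @ g # s" "reduced (s @ r)" "pull (bar g) (s @ r) \<noteq> None"
  using assms(2)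
proof (induction p arbitrary: thesis)
  case (Cons x p)
  show ?case
  proof (cases "reduced (p @ r)")
    case True
    then show ?thesis using Cons.prems(1)[of "[]" x p] Cons.prems(2) by auto
  next
    case False
    then show ?thesis using Cons.IH Cons.prems(1) by (metis append_Cons)
  qed
qed (use assms in simp)

section \<open>Shortest conjugates\<close>

primrec lpow :: "'e list \<Rightarrow> nat \<Rightarrow> 'e list" where
  "lpow p 0 = []"
| "lpow p (Suc n) = p @ lpow p n"

lemma lpow_Suc2: "lpow p (Suc n) = lpow p n @ p"
  by (induction n) auto

lemma lpow_add: "lpow p (m + n) = lpow p m @ lpow p n"
  by (induction m) auto

lemma length_lpow [simp]: "length (lpow p n) = n * length p"
  by (induction n) auto

lemma lpow_lists [simp]: "p \<in> lists E \<Longrightarrow> lpow p n \<in> lists E"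
  by (induction n) auto

lemma wlen_lpow_le: assumes "p \<in> lists E" shows "wlen (lpow p n) \<le> n * wlen p"
proof (induction n)
  case (Suc n)
  then show ?case using wlen_append_le[OF assms lpow_lists[OF assms, of n]] by simp
qed simp

lemma lpow_conj: "g @ h \<doteq> h @ p \<Longrightarrow> lpow g n @ h \<doteq> h @ lpow p n"
proof (induction n)
  case (Suc n)
  then have "g @ lpow g n @ h \<doteq> g @ h @ lpow p n" by (intro eqv_append_left)
  also have "\<dots> \<doteq> h @ p @ lpow p n" using eqv_append_right[OF Suc.prems, of "lpow p n"] by simp
  finally show ?case by simp
qed simp

definition shortest_conj :: "'e list \<Rightarrow> bool" where
  "shortest_conj p \<longleftrightarrow> p \<in> lists E \<and> (\<forall>d\<in>lists E. wlen p \<le> wlen (d @ p @ rinv d))"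

lemma shortest_conj_conj:
  assumes p: "shortest_conj p" and q: "q \<in> lists E" "d \<in> lists E" "q \<doteq> d @ p @ rinv d"
    and l: "wlen q \<le> wlen p"
  shows "shortest_conj q"
  unfolding shortest_conj_def
proof (intro conjI ballI q(1))
  fix c assume c: "c \<in> lists E"
  have "wlen q \<le> wlen ((c @ d) @ p @ rinv (c @ d))"
    using p c q(2) l unfolding shortest_conj_def by (meson append_in_lists_conv le_trans)
  also have "\<dots> = wlen (c @ q @ rinv c)"
    using eqv_context[OF q(3), of c "rinv c"] by (intro wlen_eqv) (simp add: eqv_commute)
  finally show "wlen q \<le> wlen (c @ q @ rinv c)" .
qed

text \<open>
  All powers of a shortest conjugate are geodesic. Let \<open>p\<^sup>n\<close> be geodesic but not \<open>p\<^sup>n\<^sup>+\<^sup>1\<close>. A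
  letter of the first factor cancels against a letter of the last one, so it can be pushed to
  the end of the first factor; write \<open>p = z bar k\<close> with a shorter \<open>z\<close>. The conjugate \<open>q = bar k
  z\<close> is then also shortest, and by induction \<open>q\<^sup>n = bar k p\<^sup>n k\<close> has the same length as \<open>p\<^sup>n\<close>.
  But \<open>p\<^sup>n\<close> can be shortened at both ends, which contradicts \<open>dichotomy\<close>.
\<close>
lemma shortest_conj_lpow:
  "shortest_conj p \<Longrightarrow> wlen (lpow p n) = n * wlen p"
proof (induction n arbitrary: p)
  case (Suc n)
  note sc = \<open>shortest_conj p\<close>
  have pE: "p \<in> lists E" using sc by (simp add: shortest_conj_def)
  define c where "c = nf p"
  define r where "r = nf (lpow p n)"
  have cE: "c \<in> lists E" using pE by (simp add: c_def nf_lists)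
  have c: "reduced c" "length c = wlen p" "c \<doteq> p"
    using pE by (auto simp: c_def reduced_nf wlen_def nf_eqv_self)
  have r: "reduced r" "length r = n * wlen p" "r \<doteq> lpow p n"
    using pE Suc.IH[OF sc] by (auto simp: r_def reduced_nf wlen_def intro!: nf_eqv_self lpow_lists)
  have eq: "lpow p (Suc n) \<doteq> c @ r" using eqv_append[OF eqv_sym[OF c(3)] eqv_sym[OF r(3)]] by simp
  show ?case
  proof (rule ccontr)
    assume "wlen (lpow p (Suc n)) \<noteq> Suc n * wlen p"
    then have "wlen (c @ r) \<noteq> length (c @ r)" using wlen_eqv[OF eq] c r by simp
    then have "\<not> reduced (c @ r)" by (simp add: reduced_iff_wlen)
    then obtain c1 g s where dec: "c = c1 @ g # s"
      and pl: "pull (bar g) (s @ r) \<noteq> None"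
      using first_cancellation[OF r(1)] by metis
    have "pull (bar g) s = None" using c(1) reduced_append[of c1 "g # s"] dec by simp
    then have av: "avoids (bar g) s" and pk: "pull (carry (bar g) s) r \<noteq> None"
      using pl pull_append by blast+
    (* The letter g of the first factor cancels in r, so it can be pushed past s to the end of the
       first factor, where it is bar k. *)
    define k where "k = carry (bar g) s"
    have gE: "g \<in> E" and c1E: "c1 \<in> lists E" using dec cE by auto
    have kE: "k \<in> E" using carry_E[OF av] gE by (simp add: k_def)
    define z where "z = c1 @ shift (bar g) s"
    have zE: "z \<in> lists E" using c1E shift_lists[OF av] by (simp add: z_def)
    have lz: "Suc (length z) = wlen p" using c(2) dec by (simp add: z_def)
    have "c @ [k] = c1 @ g # (s @ [k])" using dec by simp
    also have "\<dots> \<doteq> c1 @ g # (bar g # shift (bar g) s)"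
      unfolding k_def by (intro eqv_append_left eqv_Cons carry_eqv[OF av])
    also have "\<dots> \<doteq> z" unfolding z_def by (rule eqv_cancel_context[OF gE])
    finally have "c @ [k] \<doteq> z" .
    then have pk_z: "p @ [k] \<doteq> z"
      by (rule eqv_trans[OF eqv_append_right[OF eqv_sym[OF c(3)]]])
    define q where "q = bar k # z"
    have q_conj: "q \<doteq> [bar k] @ p @ rinv [bar k]"
      unfolding q_def using eqv_Cons[OF eqv_sym[OF pk_z], of "bar k"] by simp
    have qE: "q \<in> lists E" using zE kE by (simp add: q_def)
    have lq: "wlen q \<le> wlen p" using wlen_le_length[of q] lz by (simp add: q_def)
    have scq: "shortest_conj q"
      using shortest_conj_conj[OF sc qE _ q_conj lq] kE by simp
    have "[bar k] \<in> lists E" using kE by simp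
    then have "wlen p \<le> wlen q"
      using sc unfolding shortest_conj_def wlen_eqv[OF q_conj] by blast
    with lq have wq: "wlen q = wlen p" by simp
    have "p @ [k] \<doteq> [k] @ q"
      unfolding q_def using eqv_trans[OF pk_z eqv_sym] eqv_cancel_context[OF kE, of "[]" z] by simp
    then have "lpow p n @ [k] \<doteq> [k] @ lpow q n" by (rule lpow_conj)
    then have rk: "r @ [k] \<doteq> [k] @ lpow q n"
      by (rule eqv_trans[OF eqv_append_right[OF r(3)]])
    have "bar k # r @ [k] \<doteq> bar k # k # lpow q n"
      using eqv_Cons[OF rk] by simp
    also have "\<dots> \<doteq> lpow q n" using eqv_cancel_context[of "bar k" "[]"] kE by simp
    finally have w: "wlen (bar k # r @ [k]) = length r"
      using Suc.IH[OF scq] wq r(2) wlen_eqv by simp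
    have "r \<noteq> []" using pk k_def by auto
    then obtain m where m: "n = Suc m" using r(2) by (cases n) auto
    have "r @ [k] \<doteq> lpow p m @ p @ [k]"
      using eqv_append_right[OF r(3), of "[k]"] by (simp add: m lpow_Suc2 del: lpow.simps)
    also have "\<dots> \<doteq> lpow p m @ z" by (rule eqv_append_left[OF pk_z])
    finally have "wlen (r @ [k]) \<le> wlen (lpow p m) + length z"
      using wlen_append_le_right[of "lpow p m" z] pE zE by (simp add: wlen_eqv)
    also have "\<dots> \<le> m * wlen p + length z"
      using wlen_lpow_le[OF pE] by simp
    also have "\<dots> < length r" using lz r(2) m by simp
    finally have "wlen (r @ [k]) < length r" .
    from dichotomy[OF r(1) _ kE this] pk w show False by (simp add: k_def)
  qed
qed simp

section \<open>Signed crossings of walls\<close>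

lemma pull_append_Some: "pull g s = Some u \<Longrightarrow> pull g (s @ t) = Some (u @ t)"
  by (induction s arbitrary: g u) (auto split: if_splits)

lemma reduced_prefix: "reduced (s @ t) \<Longrightarrow> reduced s"
proof (induction s)
  case (Cons x s)
  then show ?case
    using pull_append_Some[of "bar x" s _ t] by (cases "pull (bar x) s") auto
qed simp

text \<open>
  A pair \<open>(h, e)\<close> stands for the edge \<open>e\<close> of the universal cover at the end of the lift of the
  word \<open>h\<close>. Closed sets are unions of classes of parallel edges, that is, sets of walls.
\<close>
definition closed :: "('e list \<times> 'e) set \<Rightarrow> bool" where
  "closed U \<longleftrightarrow> (\<forall>h h' e. (h, e) \<in> U \<longrightarrow> h \<doteq> h' \<longrightarrow> (h', e) \<in> U) \<and>
     (\<forall>h e f. (h, e) \<in> U \<longrightarrow> ind e f \<longrightarrow> (h @ [f], res e f) \<in> U)"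

lemma closed_eqv: "closed U \<Longrightarrow> h \<doteq> h' \<Longrightarrow> (h, e) \<in> U \<longleftrightarrow> (h', e) \<in> U"
  unfolding closed_def using eqv_sym[of h h'] by iprover

lemma closed_step:
  assumes U: "closed U" and "ind e f"
  shows "(h @ [f], res e f) \<in> U \<longleftrightarrow> (h, e) \<in> U"
proof
  assume "(h @ [f], res e f) \<in> U"
  then have "((h @ [f]) @ [bar f], res (res e f) (bar f)) \<in> U"
    using U ind_bar_res[OF assms(2)] unfolding closed_def by blast
  moreover have "(h @ [f]) @ [bar f] \<doteq> h"
    using eqv_cancel_context[of f h "[]"] ind_E[OF ind_sym[OF assms(2)]] by simp
  ultimately show "(h, e) \<in> U"
    using closed_eqv[OF U] res_res_bar[OF ind_sym[OF assms(2)]] by simp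
qed (use assms in \<open>auto simp: closed_def\<close>)

text \<open>
  The contribution of the edge \<open>(h, e)\<close>, traversed from its start: a negative edge counts as the
  positive edge \<open>(h @ [e], bar e)\<close>, traversed backwards.
\<close>
definition sgn :: "('e list \<times> 'e) set \<Rightarrow> 'e list \<Rightarrow> 'e \<Rightarrow> int" where
  "sgn U h e = (if pos e then of_bool ((h, e) \<in> U) else - of_bool ((h @ [e], bar e) \<in> U))"

primrec cross :: "('e list \<times> 'e) set \<Rightarrow> 'e list \<Rightarrow> 'e list \<Rightarrow> int" where
  "cross U h [] = 0"
| "cross U h (e # p) = sgn U h e + cross U (h @ [e]) p"

lemma cross_append: "cross U h (p @ q) = cross U h p + cross U (h @ p) q"
  by (induction p arbitrary: h) auto

lemma sgn_base: "closed U \<Longrightarrow> h \<doteq> h' \<Longrightarrow> sgn U h e = sgn U h' e"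
  using closed_eqv[of U h h' e] closed_eqv[of U "h @ [e]" "h' @ [e]" "bar e"] eqv_append_right[of h h' "[e]"]
  by (auto simp: sgn_def)

lemma cross_base: "closed U \<Longrightarrow> h \<doteq> h' \<Longrightarrow> cross U h p = cross U h' p"
proof (induction p arbitrary: h h')
  case (Cons e p)
  then show ?case using sgn_base[of U h h' e] Cons.IH[of "h @ [e]" "h' @ [e]"] eqv_append_right
    by simp
qed simp

lemma sgn_square:
  assumes U: "closed U" and ab: "ind a b"
  shows "sgn U (h @ [b]) (res a b) = sgn U h a"
proof -
  have "((h @ [a]) @ [res b a], bar (res a b)) \<in> U \<longleftrightarrow> (h @ [a], bar a) \<in> U"
    using closed_step[OF U ind_bar[OF ab], of "h @ [a]"] res_bar[OF ab] by simp
  moreover have "(h @ [a]) @ [res b a] \<doteq> (h @ [b]) @ [res a b]"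
    using eqv_append_left[OF eqv_square[OF ab]] by simp
  ultimately show ?thesis
    using closed_step[OF U ab] closed_eqv[OF U] pos_res[OF ab] by (auto simp: sgn_def)
qed

text \<open>
  Opposite edges of a square lie on the same wall, so they contribute equally.
\<close>
lemma cross_eqv: "p \<doteq> q \<Longrightarrow> closed U \<Longrightarrow> cross U h p = cross U h q"
proof (induction arbitrary: h rule: eqv.induct)
  case (eqv_context p q u v)
  then show ?case
    using cross_base[of U "(h @ u) @ p" "(h @ u) @ q" v] eqv_append_left by (simp add: cross_append)
next
  case (eqv_cancel e)
  have "h @ [e, bar e] \<doteq> h" using eqv_cancel_context[OF eqv_cancel(1), of h "[]"] by simp
  then show ?case
    using closed_eqv[OF eqv_cancel(2)] pos_bar[OF eqv_cancel(1)] by (simp add: sgn_def)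
next
  case (eqv_square a b)
  then show ?case using sgn_square[of U a b h] sgn_square[of U b a h] by (simp add: ind_sym)
qed auto

lemma cross_bound: "\<bar>cross U h p\<bar> \<le> int (length p)"
proof (induction p arbitrary: h)
  case (Cons e p)
  have "\<bar>sgn U h e\<bar> \<le> 1" by (simp add: sgn_def)
  then show ?case using Cons[of "h @ [e]"] by simp
qed simp

lemma cross_nonpos:
  "(\<And>p1 e p2. p = p1 @ e # p2 \<Longrightarrow> sgn U (h @ p1) e \<le> 0) \<Longrightarrow> cross U h p \<le> 0"
proof (induction p arbitrary: h)
  case (Cons x p)
  have "sgn U ((h @ [x]) @ p1) e \<le> 0" if "p = p1 @ e # p2" for p1 e p2
    using Cons.prems[of "x # p1" e p2] that by simp
  then have "cross U (h @ [x]) p \<le> 0" by (rule Cons.IH)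
  then show ?case using Cons.prems[of "[]" x p] by simp
qed simp

lemma cross_nonneg:
  "(\<And>p1 e p2. p = p1 @ e # p2 \<Longrightarrow> sgn U (h @ p1) e \<ge> 0) \<Longrightarrow> cross U h p \<ge> 0"
proof (induction p arbitrary: h)
  case (Cons x p)
  have "sgn U ((h @ [x]) @ p1) e \<ge> 0" if "p = p1 @ e # p2" for p1 e p2
    using Cons.prems[of "x # p1" e p2] that by simp
  then have "cross U (h @ [x]) p \<ge> 0" by (rule Cons.IH)
  then show ?case using Cons.prems[of "[]" x p] by simp
qed simp

lemma cross_neg:
  assumes st: "\<And>p1 e p2. p = p1 @ e # p2 \<Longrightarrow> sgn U (h @ p1) e \<le> 0"
    and p: "p = p1 @ e # p2" and e: "sgn U (h @ p1) e = -1"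
  shows "cross U h p \<le> -1"
proof -
  have "cross U h p1 \<le> 0"
    by (rule cross_nonpos) (use st p in auto)
  moreover have "cross U (h @ p1 @ [e]) p2 \<le> 0"
  proof (rule cross_nonpos)
    fix q1 f q2 assume "p2 = q1 @ f # q2"
    then show "sgn U ((h @ p1 @ [e]) @ q1) f \<le> 0"
      using st[of "p1 @ e # q1" f q2] p by simp
  qed
  ultimately show ?thesis using e p by (simp add: cross_append)
qed

lemma cross_pos:
  assumes st: "\<And>p1 e p2. p = p1 @ e # p2 \<Longrightarrow> sgn U (h @ p1) e \<ge> 0"
    and p: "p = p1 @ e # p2" and e: "sgn U (h @ p1) e = 1"
  shows "cross U h p \<ge> 1"
proof -
  have "cross U h p1 \<ge> 0"
    by (rule cross_nonneg) (use st p in auto)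
  moreover have "cross U (h @ p1 @ [e]) p2 \<ge> 0"
  proof (rule cross_nonneg)
    fix q1 f q2 assume "p2 = q1 @ f # q2"
    then show "sgn U ((h @ p1 @ [e]) @ q1) f \<ge> 0"
      using st[of "p1 @ e # q1" f q2] p by simp
  qed
  ultimately show ?thesis using e p by (simp add: cross_append)
qed

lemma cross_lpow: "cross U h (lpow p n) = (\<Sum>k<n. cross U (h @ lpow p k) p)"
  by (induction n) (simp_all add: lpow_Suc2 cross_append del: lpow.simps(2))

text \<open>
  The translates by \<open>A\<close> of the wall through \<open>(h, e)\<close>; a single wall for \<open>A = {[]}\<close>.
\<close>
definition wall :: "'e list set \<Rightarrow> 'e list \<Rightarrow> 'e \<Rightarrow> ('e list \<times> 'e) set" where
  "wall A h e = {(h', e'). \<exists>a\<in>A. \<exists>d. avoids e d \<and> carry e d = e' \<and> h' \<doteq> a @ h @ d}"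

lemma closed_wall: "closed (wall A h e)"
  unfolding closed_def
proof (intro conjI allI impI)
  fix k k' f assume "(k, f) \<in> wall A h e" "k \<doteq> k'"
  then obtain a d where ad: "a \<in> A" "avoids e d" "carry e d = f" "k \<doteq> a @ h @ d"
    by (auto simp: wall_def)
  have "k' \<doteq> a @ h @ d" by (rule eqv_trans[OF eqv_sym[OF \<open>k \<doteq> k'\<close>] ad(4)])
  then show "(k', f) \<in> wall A h e" using ad(1-3) unfolding wall_def by blast
next
  fix k f c assume *: "(k, f) \<in> wall A h e" "ind f c"
  then obtain a d where ad: "a \<in> A" "avoids e d" "carry e d = f" "k \<doteq> a @ h @ d"
    by (auto simp: wall_def)
  have "avoids e (d @ [c])" "carry e (d @ [c]) = res f c"
    using ad *(2) by (auto simp: avoids_append carry_append)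
  moreover have "k @ [c] \<doteq> a @ h @ d @ [c]" using eqv_append_right[OF ad(4), of "[c]"] by simp
  ultimately show "(k @ [c], res f c) \<in> wall A h e" using ad(1) unfolding wall_def by blast
qed

lemma closed_UN: assumes U: "\<And>i. closed (U i)" shows "closed (\<Union>i. U i)"
  unfolding closed_def
proof (intro conjI allI impI)
  fix h h' e assume "(h, e) \<in> (\<Union>i. U i)" and h: "h \<doteq> h'"
  then obtain i where "(h, e) \<in> U i" by blast
  then have "(h', e) \<in> U i" using closed_eqv[OF U h] by simp
  then show "(h', e) \<in> (\<Union>i. U i)" by blast
next
  fix h e f assume "(h, e) \<in> (\<Union>i. U i)" and ef: "ind e f"
  then obtain i where "(h, e) \<in> U i" by blast
  then have "(h @ [f], res e f) \<in> U i" using closed_step[OF U ef] by simp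
  then show "(h @ [f], res e f) \<in> (\<Union>i. U i)" by blast
qed

text \<open>
  Two parallel edges are joined by a strip, and the part of the reduced word between them is
  homotopic to a side of this strip, so that \<open>no_recrossing\<close> applies.
\<close>
lemma no_both_signs:
  assumes red: "reduced p" and E: "h \<in> lists E" "p \<in> lists E"
    and p: "p = p1 @ e # p2" "p = p3 @ f # p4" and pos: "pos e" "\<not> pos f"
    and mem: "(h @ p1, e) \<in> wall {[]} z c" "(h @ p3 @ [f], bar f) \<in> wall {[]} z c"
  shows False
proof -
  obtain d1 where d1: "avoids c d1" "carry c d1 = e" "h @ p1 \<doteq> z @ d1"
    using mem(1) by (auto simp: wall_def)
  obtain d2 where d2: "avoids c d2" "carry c d2 = bar f" "h @ p3 @ [f] \<doteq> z @ d2"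
    using mem(2) by (auto simp: wall_def)
  define d where "d = rinv d1 @ d2"
  have d: "avoids e d" "carry e d = bar f"
    using avoids_rinv[OF d1(1)] d1(2) d2 by (auto simp: d_def avoids_append carry_append)
  have E': "e \<in> E" "f \<in> E" "p1 \<in> lists E" "p3 \<in> lists E"
    using E(2) E(2)[unfolded p(1)] E(2)[unfolded p(2)] by simp_all
  have "h @ p1 @ d \<doteq> (z @ d1) @ d" using eqv_append_right[OF d1(3), of d] by simp
  also have "\<dots> \<doteq> z @ d2" using cancel_right[OF avoids_lists[OF d1(1)], of z d2] by (simp add: d_def)
  also have "\<dots> \<doteq> h @ p3 @ [f]" by (rule eqv_sym[OF d2(3)])
  finally have pd: "p1 @ d \<doteq> p3 @ [f]" by (rule eqv_left_cancel[OF E(1)])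
  have "p1 @ e # p2 = p3 @ f # p4" using p by simp
  then obtain us where "p1 = p3 @ us \<and> us @ e # p2 = f # p4 \<or> p1 @ us = p3 \<and> e # p2 = us @ f # p4"
    unfolding append_eq_append_conv2 by blast
  then show False
  proof (elim disjE conjE)
    assume us: "p1 = p3 @ us" "us @ e # p2 = f # p4"
    then obtain r where r: "us = f # r" using pos by (cases us) auto
    then have pp: "p = p3 @ (f # r @ [e]) @ p2" using p us by simp
    have red': "reduced (f # r @ [e])"
      by (rule reduced_prefix[OF reduced_append[OF red[unfolded pp]]])
    have "p3 @ [f] @ r @ d \<doteq> p3 @ [f] @ []" using pd us r by simp
    then have "[f] @ r @ d \<doteq> [f] @ []" by (rule eqv_left_cancel[OF E'(4)])
    then have "r @ d \<doteq> []" by (rule eqv_left_cancel[rotated]) (use E'(2) in simp)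
    then have "r @ d \<doteq> rinv d @ d"
      by (rule eqv_trans[OF _ eqv_sym[OF rinv_left[OF avoids_lists[OF d(1)]]]])
    then have "rinv d \<doteq> r"
      by (rule eqv_sym[OF eqv_right_cancel[OF avoids_lists[OF d(1)]]])
    then show False
      using no_recrossing[OF red' E'(2), of "rinv d"] avoids_rinv[OF d(1)] d(2) by simp
  next
    assume us: "p1 @ us = p3" "e # p2 = us @ f # p4"
    then obtain r where r: "us = e # r" using pos by (cases us) auto
    then have pp: "p = p1 @ (e # r @ [f]) @ p4" using p us by simp
    have red': "reduced (e # r @ [f])"
      by (rule reduced_prefix[OF reduced_append[OF red[unfolded pp]]])
    have "p1 @ d \<doteq> p1 @ e # r @ [f]" using pd by (simp add: us(1)[symmetric] r)
    then have "d \<doteq> e # r @ [f]" by (rule eqv_left_cancel[OF E'(3)])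
    have "e # shift e d \<doteq> d @ [bar f]" using eqv_sym[OF carry_eqv[OF d(1)]] d(2) by simp
    also have "\<dots> \<doteq> (e # r @ [f]) @ [bar f]"
      by (rule eqv_append_right[OF \<open>d \<doteq> e # r @ [f]\<close>])
    also have "\<dots> \<doteq> e # r"
      using eqv_cancel_context[OF E'(2), of "e # r" "[]"] by simp
    finally have "[e] @ shift e d \<doteq> [e] @ r" by simp
    then have "shift e d \<doteq> r" by (rule eqv_left_cancel[rotated]) (use E'(1) in simp)
    then show False
      using no_recrossing[OF red' E'(1), of "shift e d"] avoids_shift[OF d(1)] d(2) by simp
  qed
qed

text \<open>
  The words \<open>h c\<^sup>k\<close> lead to points on the axis of \<open>g\<close>. The translation by \<open>a\<close> maps a wall that
  the axis crosses positively in \<open>c\<close> to one that it crosses negatively in \<open>c\<close>. Apply the powers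
  of \<open>g\<close> to obtain the set \<open>U\<close> of walls, each of which is crossed negatively by the axis and
  positively by its translate. Along \<open>c\<^sup>N\<close> this gives a crossing number of at most \<open>-N\<close> on the
  axis and of at least \<open>N\<close> on the translate. The two segments form a quadrilateral whose other
  sides have a length that does not depend on \<open>N\<close>.
\<close>
lemma no_opposite_translates:
  assumes E: "a \<in> lists E" "g \<in> lists E" "h \<in> lists E" "c \<in> lists E"
    and comm: "a @ g \<doteq> g @ a" and ax: "g @ h \<doteq> h @ c"
    and red: "\<And>n. reduced (lpow c n)"
    and f: "c = c1 @ f # c2" "pos f" and f': "c = d1 @ f' # d2" "\<not> pos f'"
    and mem: "(h @ d1 @ [f'], bar f') \<in> wall {a} (h @ c1) f"
  shows False
proof -
  define W where "W k = wall {[]} (a @ h @ lpow c k @ c1) f" for k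
  define U where "U = (\<Union>k. W k)"
  have U: "closed U" unfolding U_def W_def by (intro closed_UN closed_wall)
  have posW: "((a @ h) @ lpow c k @ c1, f) \<in> W k" for k
    by (auto simp: W_def wall_def intro!: exI[of _ "[]"])
  have ck: "h @ lpow c k \<doteq> lpow g k @ h" for k
    using lpow_conj[OF ax] by (rule eqv_sym)
  have ak: "lpow g k @ a \<doteq> a @ lpow g k" for k
    by (rule lpow_conj[OF eqv_sym[OF comm]])
  have negW: "(h @ (lpow c k @ d1) @ [f'], bar f') \<in> W k" for k
  proof -
    obtain d where d: "avoids f d" "carry f d = bar f'" "h @ d1 @ [f'] \<doteq> a @ (h @ c1) @ d"
      using mem by (auto simp: wall_def)
    have "h @ (lpow c k @ d1) @ [f'] \<doteq> lpow g k @ (h @ d1 @ [f'])"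
      using eqv_append_right[OF ck, of k "d1 @ [f']"] by simp
    also have "\<dots> \<doteq> lpow g k @ (a @ (h @ c1) @ d)" by (rule eqv_append_left[OF d(3)])
    also have "\<dots> \<doteq> a @ lpow g k @ h @ c1 @ d"
      using eqv_append_right[OF ak, of k "h @ c1 @ d"] by simp
    also have "\<dots> \<doteq> a @ (h @ lpow c k) @ c1 @ d"
      using eqv_context[OF eqv_sym[OF ck], of a k "c1 @ d"] by simp
    finally show ?thesis using d(1,2) by (auto simp: W_def wall_def)
  qed
  (* The wall W k is only known to be crossed in the k-th period, and k may exceed N, so two
     crossings are compared on a segment that contains both. *)
  have ext: "\<exists>q. lpow c (max N (Suc k)) = lpow c N @ q" for N k
    by (metis lpow_add le_add_diff_inverse max.cobounded1)
  have ext2: "\<exists>q. lpow c (max N (Suc k)) = lpow c k @ c @ q" for N k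
    by (metis lpow_add le_add_diff_inverse max.cobounded2 lpow_Suc2 append.assoc)
  have A: "sgn U (h @ p1) e \<le> 0" if p: "lpow c N = p1 @ e # p2" for N p1 e p2
  proof (rule ccontr)
    assume "\<not> sgn U (h @ p1) e \<le> 0"
    then obtain k where k: "pos e" "(h @ p1, e) \<in> W k"
      by (auto simp: sgn_def U_def of_bool_def split: if_splits)
    obtain q q' where "lpow c (max N (Suc k)) = lpow c N @ q"
      "lpow c (max N (Suc k)) = lpow c k @ c @ q'" using ext ext2 by blast
    then have "lpow c (max N (Suc k)) = p1 @ e # (p2 @ q)"
      "lpow c (max N (Suc k)) = (lpow c k @ d1) @ f' # (d2 @ q')" using p f' by auto
    from no_both_signs[OF red E(3) lpow_lists[OF E(4)] this k(1) f'(2)] k(2) negW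
    show False unfolding W_def by blast
  qed
  have B: "sgn U ((a @ h) @ p1) e \<ge> 0" if p: "lpow c N = p1 @ e # p2" for N p1 e p2
  proof (rule ccontr)
    assume "\<not> sgn U ((a @ h) @ p1) e \<ge> 0"
    then obtain k where k: "\<not> pos e" "((a @ h) @ p1 @ [e], bar e) \<in> W k"
      by (auto simp: sgn_def U_def of_bool_def split: if_splits)
    obtain q q' where "lpow c (max N (Suc k)) = lpow c N @ q"
      "lpow c (max N (Suc k)) = lpow c k @ c @ q'" using ext ext2 by blast
    then have "lpow c (max N (Suc k)) = (lpow c k @ c1) @ f # (c2 @ q')"
      "lpow c (max N (Suc k)) = p1 @ e # (p2 @ q)" using p f by auto
    from no_both_signs[OF red _ lpow_lists[OF E(4)] this f(2) k(1)] k(2) posW E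
    show False unfolding W_def by (metis append_in_lists_conv)
  qed
  have block: "lpow c (Suc k) = (lpow c k @ p1) @ e # p2" if "c = p1 @ e # p2" for k p1 e p2
    using that by (metis append.assoc lpow_Suc2)
  have negc: "cross U (h @ lpow c k) c \<le> -1" for k
  proof (rule cross_neg[OF _ f'(1)])
    show "sgn U ((h @ lpow c k) @ p1) e \<le> 0" if "c = p1 @ e # p2" for p1 e p2
      using A[OF block[OF that]] by simp
    show "sgn U ((h @ lpow c k) @ d1) f' = -1"
      using negW[of k] f'(2) by (auto simp: sgn_def U_def)
  qed
  have posc: "cross U ((a @ h) @ lpow c k) c \<ge> 1" for k
  proof (rule cross_pos[OF _ f(1)])
    show "sgn U (((a @ h) @ lpow c k) @ p1) e \<ge> 0" if "c = p1 @ e # p2" for p1 e p2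
      using B[OF block[OF that]] by simp
    show "sgn U (((a @ h) @ lpow c k) @ c1) f = 1"
      using posW[of k] f(2) by (auto simp: sgn_def U_def)
  qed
  (* The path t joins the axis to its translate by a. As a commutes with g, it also joins the points
     N periods further on. *)
  define t where "t = rinv h @ a @ h"
  define N where "N = Suc (length t)"
  have neg: "cross U h (lpow c N) \<le> - int N"
    using sum_mono[of "{..<N}" "\<lambda>k. cross U (h @ lpow c k) c" "\<lambda>_. -1"] negc
    by (simp add: cross_lpow)
  have pos: "cross U (a @ h) (lpow c N) \<ge> int N"
    using sum_mono[of "{..<N}" "\<lambda>_. 1" "\<lambda>k. cross U ((a @ h) @ lpow c k) c"] posc
    by (simp add: cross_lpow)
  have ht: "h @ t \<doteq> a @ h" using cancel_right[OF E(3), of "[]" "a @ h"] by (simp add: t_def)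
  have "h @ t @ lpow c N \<doteq> a @ h @ lpow c N"
    using eqv_append_right[OF ht, of "lpow c N"] by simp
  also have "\<dots> \<doteq> a @ lpow g N @ h" by (rule eqv_append_left[OF ck])
  also have "\<dots> \<doteq> lpow g N @ a @ h"
    using eqv_append_right[OF eqv_sym[OF ak], of N h] by simp
  also have "\<dots> \<doteq> lpow g N @ h @ t" by (rule eqv_append_left[OF eqv_sym[OF ht]])
  also have "\<dots> \<doteq> h @ lpow c N @ t"
    using eqv_append_right[OF eqv_sym[OF ck], of N t] by simp
  finally have "t @ lpow c N \<doteq> lpow c N @ t" by (rule eqv_left_cancel[OF E(3)])
  then have "cross U h (t @ lpow c N) = cross U h (lpow c N @ t)" by (rule cross_eqv[OF _ U])
  moreover have "cross U (h @ t) (lpow c N) = cross U (a @ h) (lpow c N)"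
    by (rule cross_base[OF U ht])
  ultimately have "cross U h t + cross U (a @ h) (lpow c N)
      = cross U h (lpow c N) + cross U (h @ lpow c N) t"
    by (simp add: cross_append)
  then show False
    using neg pos cross_bound[of U h t] cross_bound[of U "h @ lpow c N" t] by (simp add: N_def)
qed

lemma axis_exists:
  assumes g: "g \<in> lists E"
  obtains h c where "h \<in> lists E" "c \<in> lists E" "g @ h \<doteq> h @ c" "\<And>n. reduced (lpow c n)"
proof -
  (* The word h leads to a point that g moves by the least possible distance. *)
  let ?P = "\<lambda>h. h \<in> lists E"
  define h where "h = arg_min (\<lambda>h. wlen (rinv h @ g @ h)) ?P"
  have h: "h \<in> lists E"
    unfolding h_def by (rule arg_min_natI[of ?P "[]"]) simp
  have min: "wlen (rinv h @ g @ h) \<le> wlen (rinv k @ g @ k)" if "k \<in> lists E" for k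
    unfolding h_def by (rule arg_min_nat_le[of ?P, OF that])
  define c where "c = nf (rinv h @ g @ h)"
  have gE: "rinv h @ g @ h \<in> lists E" using g h by simp
  have cE: "c \<in> lists E" using gE by (simp add: c_def nf_lists del: append_in_lists_conv)
  have ce: "c \<doteq> rinv h @ g @ h" using nf_eqv_self[OF gE] by (simp add: c_def)
  have "h @ c \<doteq> h @ rinv h @ g @ h" by (rule eqv_append_left[OF ce])
  also have "\<dots> \<doteq> g @ h" using cancel_right[OF h, of "[]"] by simp
  finally have ax: "g @ h \<doteq> h @ c" by (rule eqv_sym)
  have "shortest_conj c"
    unfolding shortest_conj_def
  proof (intro conjI ballI cE)
    fix d assume d: "d \<in> lists E"
    have "wlen c \<le> wlen (rinv (h @ rinv d) @ g @ (h @ rinv d))"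
      using min[of "h @ rinv d"] d h wlen_eqv[OF ce] by simp
    also have "\<dots> = wlen (d @ c @ rinv d)"
      using eqv_context[OF ce, of d "rinv d"] by (intro wlen_eqv) (simp add: eqv_commute)
    finally show "wlen c \<le> wlen (d @ c @ rinv d)" .
  qed
  moreover have "length c = wlen c" by (simp add: c_def wlen_def nf_reduced reduced_nf)
  ultimately have "reduced (lpow c n)" for n
    by (simp add: reduced_iff_wlen shortest_conj_lpow)
  with h cE ax that show ?thesis by blast
qed

end

section \<open>Commuting subgroups\<close>

text \<open>
  A commutative subgroup, given by representatives of its elements; not all words that represent
  an element need to belong to \<open>A\<close>. For a fundamental group \<open>A\<close> consists of loops only.
\<close>
locale commuting_subgroup = square_presentation +
  fixes A :: "'a list set"
  assumes A_E: "A \<subseteq> lists E" and A_Nil: "[] \<in> A"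
    and A_append: "a \<in> A \<Longrightarrow> b \<in> A \<Longrightarrow> a @ b \<in> A"
    and A_rinv: "a \<in> A \<Longrightarrow> rinv a \<in> A"
    and A_comm: "a \<in> A \<Longrightarrow> b \<in> A \<Longrightarrow> a @ b \<doteq> b @ a"
begin

lemma wall_self: "(h, e) \<in> wall A h e"
  using A_Nil by (auto simp: wall_def intro!: bexI[of _ "[]"] exI[of _ "[]"])

lemma wall_translate:
  assumes "a \<in> A" shows "(a @ h, e) \<in> wall A k f \<longleftrightarrow> (h, e) \<in> wall A k f"
proof -
  have *: "(a @ h, e) \<in> wall A k f" if aA: "a \<in> A" and m: "(h, e) \<in> wall A k f" for a h
  proof -
    obtain b d where "b \<in> A" "avoids f d" "carry f d = e" "h \<doteq> b @ k @ d"
      using m by (auto simp: wall_def)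
    then show ?thesis
      using A_append[OF aA, of b] eqv_append_left[of h "b @ k @ d" a]
      by (auto simp: wall_def intro!: bexI[of _ "a @ b"] exI[of _ d])
  qed
  have "(rinv a @ a @ h, e) \<in> wall A k f \<longleftrightarrow> (h, e) \<in> wall A k f"
    using cancel_left[of a "[]" h] assms A_E by (intro closed_eqv[OF closed_wall]) auto
  then show ?thesis using *[OF assms] *[OF A_rinv[OF assms]] by blast
qed

lemma wall_eq:
  assumes m: "(k, f) \<in> wall A h e" shows "wall A k f = wall A h e"
proof -
  obtain a d where ad: "a \<in> A" "avoids e d" "carry e d = f" "k \<doteq> a @ h @ d"
    using m by (auto simp: wall_def)
  have dE: "d \<in> lists E" and aE: "a \<in> lists E" using ad avoids_lists A_E by auto
  show ?thesis
  proof (rule equalityI; rule subrelI)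
    fix l c assume "(l, c) \<in> wall A k f"
    then obtain b d' where b: "b \<in> A" "avoids f d'" "carry f d' = c" "l \<doteq> b @ k @ d'"
      by (auto simp: wall_def)
    have "l \<doteq> (b @ a) @ h @ (d @ d')"
      using eqv_trans[OF b(4) eqv_context[OF ad(4), of b d']] by simp
    then show "(l, c) \<in> wall A h e"
      using A_append[OF b(1) ad(1)] ad b unfolding wall_def
      by (auto simp: avoids_append carry_append intro!: bexI[of _ "b @ a"] exI[of _ "d @ d'"])
  next
    fix l c assume "(l, c) \<in> wall A h e"
    then obtain b d' where b: "b \<in> A" "avoids e d'" "carry e d' = c" "l \<doteq> b @ h @ d'"
      by (auto simp: wall_def)
    have "(b @ rinv a) @ k @ (rinv d @ d') \<doteq> (b @ rinv a) @ (a @ h @ d) @ (rinv d @ d')"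
      by (rule eqv_context[OF ad(4)])
    also have "\<dots> \<doteq> b @ h @ d @ rinv d @ d'"
      using cancel_left[OF aE, of b "h @ d @ rinv d @ d'"] by simp
    also have "\<dots> \<doteq> b @ h @ d'" using cancel_right[OF dE, of "b @ h" d'] by simp
    also have "\<dots> \<doteq> l" by (rule eqv_sym[OF b(4)])
    finally have "l \<doteq> (b @ rinv a) @ k @ (rinv d @ d')" by (rule eqv_sym)
    then show "(l, c) \<in> wall A k f"
      using A_append[OF b(1) A_rinv[OF ad(1)]] avoids_rinv[OF ad(2)] ad b unfolding wall_def
      by (auto simp: avoids_append carry_append intro!: bexI[of _ "b @ rinv a"] exI[of _ "rinv d @ d'"])
  qed
qed

text \<open>
  Crossings are counted from the base point, the empty word. The index \<open>X\<close> ranges over all sets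
  of edges; the value 0 at those that are not an orbit of walls keeps the support finite.
\<close>
definition crossings :: "'a list \<Rightarrow> ('a list \<times> 'a) set \<Rightarrow> int" where
  "crossings p X = (if \<exists>h e. X = wall A h e then cross X [] p else 0)"

lemma crossings_wall: "crossings p (wall A h e) = cross (wall A h e) [] p"
  unfolding crossings_def by (rule if_P) iprover

lemma crossings_nonzero:
  assumes "crossings p X \<noteq> 0"
  obtains h e where "X = wall A h e" "cross X [] p \<noteq> 0"
proof (cases "\<exists>h e. X = wall A h e")
  case True
  then show ?thesis using assms crossings_wall that by metis
next
  case False
  then have "crossings p X = 0" unfolding crossings_def by (rule if_not_P)
  with assms show ?thesis by simp
qed

lemma crossings_eqv: "p \<doteq> q \<Longrightarrow> crossings p X = crossings q X"
  by (auto simp: crossings_def intro: cross_eqv closed_wall)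

lemma cross_translate:
  "a \<in> A \<Longrightarrow> cross (wall A k f) (a @ h) p = cross (wall A k f) h p"
proof (induction p arbitrary: h)
  case (Cons e p)
  then show ?case
    using wall_translate[OF Cons.prems, of h e] wall_translate[OF Cons.prems, of "h @ [e]" "bar e"]
    by (simp add: sgn_def)
qed simp

lemma crossings_append:
  "p \<in> A \<Longrightarrow> q \<in> A \<Longrightarrow> crossings (p @ q) X = crossings p X + crossings q X"
  using cross_translate[of p _ _ "[]" q] by (auto simp: crossings_def cross_append)

lemma cross_nonzero_step:
  assumes "cross X h p \<noteq> 0"
  obtains p1 e p2 where "p = p1 @ e # p2" "sgn X (h @ p1) e \<noteq> 0"
  using assms
proof (induction p arbitrary: h thesis)
  case (Cons x p)
  show ?case
  proof (cases "sgn X h x = 0")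
    case True
    then have "cross X (h @ [x]) p \<noteq> 0" using Cons.prems(2) by simp
    then obtain p1 e p2 where p: "p = p1 @ e # p2" "sgn X ((h @ [x]) @ p1) e \<noteq> 0"
      using Cons.IH by metis
    show ?thesis by (rule Cons.prems(1)[of "x # p1" e p2]) (use p in simp_all)
  next
    case False
    then show ?thesis using Cons.prems(1)[of "[]" x p] by simp
  qed
qed simp

lemma finite_crossings: "finite {X. crossings p X \<noteq> 0}"
proof -
  define S where "S n = {wall A (take n p) (p ! n), wall A (take n p @ [p ! n]) (bar (p ! n))}" for n
  have "X \<in> (\<Union>n<length p. S n)" if X: "crossings p X \<noteq> 0" for X
  proof -
    obtain h e where he: "X = wall A h e" and c: "cross X [] p \<noteq> 0"
      using X by (rule crossings_nonzero)
    obtain p1 f p2 where p: "p = p1 @ f # p2" "sgn X ([] @ p1) f \<noteq> 0"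
      by (rule cross_nonzero_step[OF c])
    have "(p1, f) \<in> X \<or> (p1 @ [f], bar f) \<in> X"
      using p(2) by (auto simp: sgn_def split: if_splits)
    then have "X = wall A p1 f \<or> X = wall A (p1 @ [f]) (bar f)"
      unfolding he by (rule disj_forward) (erule wall_eq[symmetric])+
    moreover have "take (length p1) p = p1" "p ! length p1 = f" "length p1 < length p"
      using p(1) by simp_all
    ultimately show ?thesis by (intro UN_I[of "length p1"]) (simp_all add: S_def)
  qed
  then have "{X. crossings p X \<noteq> 0} \<subseteq> (\<Union>n<length p. S n)" by blast
  moreover have "finite (\<Union>n<length p. S n)" by (simp add: S_def)
  ultimately show ?thesis by (rule finite_subset)
qed

text \<open>
  By \<open>no_opposite_translates\<close> the axis of \<open>g\<close> crosses the walls in the orbit of a positive edge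
  on it only positively. Without positive edges there is nothing to cancel.
\<close>
theorem crossings_detect:
  assumes g: "g \<in> A" and zero: "\<And>X. crossings g X = 0"
  shows "g \<doteq> []"
proof -
  have gE: "g \<in> lists E" using g A_E by auto
  obtain h c where h: "h \<in> lists E" "c \<in> lists E" and ax: "g @ h \<doteq> h @ c"
    and red: "\<And>n. reduced (lpow c n)"
    by (rule axis_exists[OF gE]) blast
  have c0: "cross (wall A k f) h c = 0" for k f
  proof -
    let ?X = "wall A k f"
    have "cross ?X [] (g @ h) = cross ?X [] (h @ c)" by (rule cross_eqv[OF ax closed_wall])
    moreover have "cross ?X g h = cross ?X [] h" using cross_translate[OF g, of k f "[]"] by simp
    moreover have "cross ?X [] g = 0" using zero[of ?X] by (simp add: crossings_wall)
    ultimately show ?thesis by (simp add: cross_append)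
  qed
  have "c = []"
  proof (rule ccontr)
    assume "c \<noteq> []"
    show False
    proof (cases "\<exists>c1 f c2. c = c1 @ f # c2 \<and> pos f")
      case True
      then obtain c1 f c2 where f: "c = c1 @ f # c2" "pos f" by blast
      let ?X = "wall A (h @ c1) f"
      have "sgn ?X (h @ p1) e \<ge> 0" if p: "c = p1 @ e # p2" for p1 e p2
      proof (rule ccontr)
        assume "\<not> sgn ?X (h @ p1) e \<ge> 0"
        then have "\<not> pos e" "(h @ p1 @ [e], bar e) \<in> ?X" by (auto simp: sgn_def of_bool_def split: if_splits)
        then obtain a where a: "a \<in> A" "(h @ p1 @ [e], bar e) \<in> wall {a} (h @ c1) f"
          by (auto simp: wall_def)
        show False
          using no_opposite_translates[OF _ gE h A_comm[OF a(1) g] ax red f p \<open>\<not> pos e\<close> a(2)] a(1) A_E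
          by blast
      qed
      moreover have "sgn ?X (h @ c1) f = 1" using f(2) wall_self by (simp add: sgn_def)
      ultimately have "cross ?X h c \<ge> 1" using cross_pos f(1) by blast
      then show False using c0 by simp
    next
      case False
      obtain e c' where e: "c = [] @ e # c'" using \<open>c \<noteq> []\<close> by (cases c) auto
      let ?X = "wall A (h @ [e]) (bar e)"
      have "sgn ?X (h @ p1) f \<le> 0" if "c = p1 @ f # p2" for p1 f p2
        using that False by (auto simp: sgn_def)
      moreover have "\<not> pos e" using False e by blast
      then have "sgn ?X (h @ []) e = -1" using wall_self by (simp add: sgn_def)
      ultimately have "cross ?X h c \<le> -1" using cross_neg e by blast
      then show False using c0 by simp
    qed
  qed
  then have "g @ h \<doteq> [] @ h" using ax by simp
  then show ?thesis by (rule eqv_right_cancel[OF h(1)])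
qed

end

section \<open>Fundamental groups of square complexes\<close>

lemma homotopy_refl: "edge_path K a p b \<Longrightarrow> (p, p) \<in> homotopy K a b"
  by (simp add: homotopy_def)

lemma homotopy_sym: "(p, q) \<in> homotopy K a b \<Longrightarrow> (q, p) \<in> homotopy K a b"
  by (auto simp: homotopy_def intro: equivclp_sym)

lemma homotopy_trans:
  "(p, q) \<in> homotopy K a b \<Longrightarrow> (q, r) \<in> homotopy K a b \<Longrightarrow> (p, r) \<in> homotopy K a b"
  by (auto simp: homotopy_def intro: equivclp_trans)

lemma homotopy_elementary: "elementary_homotopy K a b p q \<Longrightarrow> (p, q) \<in> homotopy K a b"
  using elementary_homotopy_paths[of K a b p q] by (auto simp: homotopy_def)

lemma edge_path_lists: "edge_path K a p b \<Longrightarrow> p \<in> lists (edges K)"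
  by (induction p arbitrary: a) auto

context complex2
begin

lemma homotopy_backtrack:
  assumes "e \<in> edges K" "edge_path K a p (src K e)" "edge_path K (src K e) q b"
  shows "(p @ [e, einv K e] @ q, p @ q) \<in> homotopy K a b"
proof -
  have "edge_path K (src K e) [e, einv K e] (src K e)"
    using assms(1) by (simp add: src_verts tgt_verts src_einv tgt_einv einv_edges)
  then have "edge_path K a (p @ [e, einv K e] @ q) b" "edge_path K a (p @ q) b"
    using assms(2,3) unfolding edge_path_append by blast+
  then show ?thesis
    by (intro homotopy_sym[OF homotopy_elementary] elementary_homotopy.backtrack)
qed

end

text \<open>
  A 2-complex whose cells are the squares of a square presentation on its edges. Only for two
  positive edges is their square required to be a cell; the other corners of the same square are
  covered by \<open>square_null_bar\<close>.
\<close>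
locale square_complex = complex2 K + square_presentation "edges K" "einv K" ind res pos
  for K :: "('v, 'e, 'm) complex2_scheme" (structure) and ind res pos +
  assumes ind_src: "ind a b \<Longrightarrow> src K a = src K b"
    and res_src: "ind a b \<Longrightarrow> src K (res a b) = tgt K b"
    and res_tgt: "ind a b \<Longrightarrow> tgt K (res a b) = tgt K (res b a)"
    and cells_are_squares: "c \<in> cells K \<Longrightarrow>
      \<exists>a b. ind a b \<and> c = [a, res b a, einv K (res a b), einv K b]"
    and squares_are_filled: "ind a b \<Longrightarrow> pos a \<Longrightarrow> pos b \<Longrightarrow>
      [a, res b a, einv K (res a b), einv K b] \<in> cells K \<or>
      [b, res a b, einv K (res b a), einv K a] \<in> cells K"
begin

notation eqv (infix "\<doteq>" 50)

lemmas edge_simps = src_verts tgt_verts src_einv tgt_einv einv_edges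

lemma ind_edges: "ind a b \<Longrightarrow> a \<in> edges K" "ind a b \<Longrightarrow> b \<in> edges K"
  "ind a b \<Longrightarrow> res a b \<in> edges K" "ind a b \<Longrightarrow> res b a \<in> edges K"
  by (auto intro: ind_E res_E dest: ind_sym)

lemma square_path:
  "ind a b \<Longrightarrow> edge_path K (src K a) [a, res b a] (tgt K (res b a))"
  using ind_edges[of a b] res_src[OF ind_sym, of a b] by (simp add: edge_simps)

lemma square_path':
  "ind a b \<Longrightarrow> edge_path K (src K a) [b, res a b] (tgt K (res b a))"
  using square_path[OF ind_sym, of a b] ind_src[of a b] res_tgt[of a b] by simp

definition square_null :: "'e \<Rightarrow> 'e \<Rightarrow> bool" where
  "square_null a b \<longleftrightarrow> ([a, res b a], [b, res a b]) \<in> homotopy K (src K a) (tgt K (res b a))"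

lemma square_null_sym: "ind a b \<Longrightarrow> square_null a b \<Longrightarrow> square_null b a"
  unfolding square_null_def ind_src[of a b] res_tgt[of a b, symmetric] by (rule homotopy_sym)

lemma square_null_cell:
  assumes ab: "ind a b" and c: "[a, res b a, einv K (res a b), einv K b] \<in> cells K"
  shows "square_null a b"
proof -
  let ?a = "res a b" and ?b = "res b a" and ?s = "src K a" and ?t = "tgt K (res b a)"
  note E = ind_edges[OF ab] and P = square_path'[OF ab]
  have srcs: "src K b = ?s" "src K ?a = tgt K b" "tgt K ?a = ?t" "src K ?b = tgt K a"
    using ind_src[OF ab] res_src[OF ab] res_tgt[OF ab] res_src[OF ind_sym[OF ab]] by auto
  have Q: "edge_path K ?s ([] @ [a, ?b, einv K ?a, einv K b] @ [b, ?a]) ?t"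
    using E srcs by (simp add: edge_simps)
  have "edge_path K ?s ([] @ [b, ?a]) ?t" using P by (simp only: append_Nil)
  then have 1: "([b, ?a], [a, ?b, einv K ?a, einv K b, b, ?a]) \<in> homotopy K ?s ?t"
    using homotopy_elementary[OF elementary_homotopy.cell[OF _ Q c]] by (simp only: append.simps)
  have "([a, ?b, einv K ?a] @ [einv K b, einv K (einv K b)] @ [?a], [a, ?b, einv K ?a] @ [?a])
      \<in> homotopy K ?s ?t"
    by (rule homotopy_backtrack) (use E srcs in \<open>simp_all add: edge_simps\<close>)
  then have 2: "([a, ?b, einv K ?a, einv K b, b, ?a], [a, ?b, einv K ?a, ?a]) \<in> homotopy K ?s ?t"
    by simp
  have "([a, ?b] @ [einv K ?a, einv K (einv K ?a)] @ [], [a, ?b] @ []) \<in> homotopy K ?s ?t"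
    by (rule homotopy_backtrack) (use E srcs in \<open>simp_all add: edge_simps\<close>)
  then have 3: "([a, ?b, einv K ?a, ?a], [a, ?b]) \<in> homotopy K ?s ?t"
    by simp
  show ?thesis
    unfolding square_null_def using homotopy_sym[OF homotopy_trans[OF 1 homotopy_trans[OF 2 3]]] .
qed

text \<open>
  Moves the corner at which the square is read from the end of \<open>a\<close> back to its start.
\<close>
lemma square_null_bar:
  assumes ab: "ind a b" and n: "square_null (einv K a) (res b a)"
  shows "square_null a b"
proof -
  let ?a = "res a b" and ?b = "res b a"
  note E = ind_edges[OF ab]
  have srcs: "src K b = src K a" "src K ?a = tgt K b" "tgt K ?a = tgt K ?b" "src K ?b = tgt K a"
    using ind_src[OF ab] res_src[OF ab] res_tgt[OF ab] res_src[OF ind_sym[OF ab]] by auto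
  have r: "res ?b (einv K a) = b" "res (einv K a) ?b = einv K ?a"
    using ab by (auto simp: res_res_bar res_bar)
  have n: "([einv K a, b], [?b, einv K ?a]) \<in> homotopy K (tgt K a) (tgt K b)"
    using n E unfolding square_null_def r by (simp add: edge_simps)
  have "([a] @ [einv K a, b] @ [?a], [a] @ [?b, einv K ?a] @ [?a]) \<in> homotopy K (src K a) (tgt K ?b)"
    by (rule homotopy_context[OF n]) (use E srcs in \<open>simp_all add: edge_simps\<close>)
  then have 1: "([a, einv K a, b, ?a], [a, ?b, einv K ?a, ?a]) \<in> homotopy K (src K a) (tgt K ?b)"
    by simp
  have "([] @ [a, einv K a] @ [b, ?a], [] @ [b, ?a]) \<in> homotopy K (src K a) (tgt K ?b)"
    by (rule homotopy_backtrack) (use E srcs in \<open>simp_all add: edge_simps\<close>)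
  then have 2: "([a, einv K a, b, ?a], [b, ?a]) \<in> homotopy K (src K a) (tgt K ?b)" by simp
  have "([a, ?b] @ [einv K ?a, einv K (einv K ?a)] @ [], [a, ?b] @ []) \<in> homotopy K (src K a) (tgt K ?b)"
    by (rule homotopy_backtrack) (use E srcs in \<open>simp_all add: edge_simps\<close>)
  then have 3: "([a, ?b, einv K ?a, ?a], [a, ?b]) \<in> homotopy K (src K a) (tgt K ?b)" by simp
  show ?thesis
    unfolding square_null_def
    using homotopy_trans[OF homotopy_sym[OF 3] homotopy_trans[OF homotopy_sym[OF 1] 2]] .
qed

lemma square_null:
  assumes ab: "ind a b" shows "square_null a b"
proof -
  have pp: "square_null a b" if "ind a b" "pos a" "pos b" for a b
    using squares_are_filled[OF that] square_null_cell[OF that(1)] square_null_cell[OF ind_sym[OF that(1)]]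
      square_null_sym[OF ind_sym[OF that(1)]] by blast
  have p: "square_null a b" if ab: "ind a b" and a: "pos b" for a b
  proof (cases "pos a")
    case False
    then have "square_null (einv K a) (res b a)"
      using ab a pos_bar ind_edges(1)[OF ab] by (intro pp) (auto simp: ind_bar pos_res ind_sym)
    then show ?thesis by (rule square_null_bar[OF ab])
  qed (use pp ab a in blast)
  show ?thesis
  proof (cases "pos b")
    case False
    have ba: "ind b a" by (rule ind_sym[OF ab])
    have i: "ind (einv K b) (res a b)" by (rule ind_bar[OF ba])
    have "square_null (res a b) (einv K b)"
      using False pos_bar ind_edges(2)[OF ab] by (intro p ind_sym[OF i]) auto
    then have "square_null (einv K b) (res a b)" by (rule square_null_sym[OF ind_sym[OF i]])
    then show ?thesis by (intro square_null_sym[OF ba] square_null_bar[OF ba])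
  qed (use p ab in blast)
qed

lemma homotopy_Cons:
  "e \<in> edges K \<Longrightarrow> (p, q) \<in> homotopy K (tgt K e) b \<Longrightarrow> (e # p, e # q) \<in> homotopy K (src K e) b"
  using homotopy_context[of p q K "tgt K e" b "src K e" "[e]" "[]" b] edge_path_verts[of "tgt K e" p b]
  by (simp add: edge_simps homotopy_def)

lemma swap_homotopy: "swap p q \<Longrightarrow> edge_path K a p b \<Longrightarrow> (p, q) \<in> homotopy K a b"
proof (induction arbitrary: a rule: swap.induct)
  case (here c d s)
  then have "([] @ [c, res d c] @ s, [] @ [d, res c d] @ s) \<in> homotopy K a b"
    by (intro homotopy_context[OF square_null[OF here(1), unfolded square_null_def]])
      (auto simp: src_verts)
  then show ?case by simp
next
  case (later s t x)
  then show ?case using homotopy_Cons by auto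
qed

lemma homotopy_paths: "(p, q) \<in> homotopy K a b \<Longrightarrow> edge_path K a p b \<and> edge_path K a q b"
  by (auto simp: homotopy_def)

lemma swaps_homotopy: "swaps p q \<Longrightarrow> edge_path K a p b \<Longrightarrow> (p, q) \<in> homotopy K a b"
proof (induction rule: rtranclp_induct)
  case (step q r)
  then have "(p, q) \<in> homotopy K a b" "(q, r) \<in> homotopy K a b"
    using swap_homotopy homotopy_paths by blast+
  then show ?case by (rule homotopy_trans)
qed (rule homotopy_refl)

text \<open>
  Cancellations and swaps of a path are homotopies, so reducing a path as a word stays within
  its homotopy class.
\<close>
lemma nf_homotopy: "edge_path K a p b \<Longrightarrow> (p, nf p) \<in> homotopy K a b"
proof (induction p arbitrary: a)
  case Nil then show ?case by (simp add: nf_def homotopy_refl)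
next
  case (Cons e p)
  then have e: "e \<in> edges K" "src K e = a" and IH: "(p, nf p) \<in> homotopy K (tgt K e) b" by auto
  have 1: "(e # p, e # nf p) \<in> homotopy K a b" using homotopy_Cons[OF e(1) IH] e(2) by simp
  show ?case
  proof (cases "pull (einv K e) (nf p)")
    case None
    then show ?thesis using 1 by (simp add: nf_Cons lmul_def)
  next
    case (Some t)
    have n: "edge_path K (tgt K e) (nf p) b" using IH by (simp add: homotopy_def)
    have "(nf p, einv K e # t) \<in> homotopy K (tgt K e) b"
      by (rule swaps_homotopy[OF pull_imp_swaps[OF Some] n])
    then have 2: "(e # nf p, e # einv K e # t) \<in> homotopy K a b"
      using homotopy_Cons[OF e(1)] e(2) by blast
    then have "edge_path K a t b" using e by (auto simp: homotopy_def edge_simps)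
    then have "([] @ [e, einv K e] @ t, [] @ t) \<in> homotopy K a b"
      using e src_verts[OF e(1)] by (intro homotopy_backtrack) auto
    then have "(e # p, t) \<in> homotopy K a b"
      using homotopy_trans[OF homotopy_trans[OF 1 2]] by simp
    then show ?thesis using Some by (simp add: nf_Cons lmul_def)
  qed
qed

text \<open>
  Forgetting the vertices loses nothing: the equality of two paths in the group is witnessed by
  their normal forms, which are homotopic to them.
\<close>
lemma eqv_imp_homotopy:
  assumes "p \<doteq> q" "edge_path K a p b" "edge_path K a q b"
  shows "(p, q) \<in> homotopy K a b"
proof -
  have p: "(p, nf p) \<in> homotopy K a b" and q: "(nf q, q) \<in> homotopy K a b"
    using nf_homotopy[OF assms(2)] homotopy_sym[OF nf_homotopy[OF assms(3)]] .
  have "(nf p, nf q) \<in> homotopy K a b"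
    by (rule swaps_homotopy[OF nf_eqv[OF assms(1)]]) (use p in \<open>simp add: homotopy_def\<close>)
  from homotopy_trans[OF homotopy_trans[OF p this] q] show ?thesis .
qed

lemma cell_eqv: "c \<in> cells K \<Longrightarrow> c \<doteq> []"
proof -
  assume "c \<in> cells K"
  then obtain a b where ab: "ind a b" and c: "c = [a, res b a, einv K (res a b), einv K b]"
    using cells_are_squares by blast
  have "c \<doteq> [b, res a b, einv K (res a b), einv K b]"
    using eqv_append_right[OF eqv_square[OF ab], of "[einv K (res a b), einv K b]"] c by simp
  also have "\<dots> \<doteq> [b, einv K b]"
    using eqv_cancel_context[of "res a b" "[b]" "[einv K b]"] ind_edges[OF ab] by simp
  also have "\<dots> \<doteq> []" using ind_edges[OF ab] by (intro eqv_cancel)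
  finally show "c \<doteq> []" .
qed

lemma homotopy_imp_eqv:
  assumes "(p, q) \<in> homotopy K a b" shows "p \<doteq> q"
proof -
  have el: "p \<doteq> q" if "elementary_homotopy K a b p q" for p q
    using that
  proof cases
    case (backtrack p q e)
    have "e \<in> edges K" using edge_path_lists[OF backtrack(4)] by simp
    then show ?thesis
      using eqv_sym[OF eqv_cancel_context[of e p q]] backtrack(1,2) by simp
  next
    case (cell p q c)
    then show ?thesis using eqv_sym[OF eqv_context[OF cell_eqv[OF cell(5)], of p q]] by simp
  qed
  have "equivclp (elementary_homotopy K a b) p q" using assms by (simp add: homotopy_def)
  then show ?thesis
  proof (induction rule: equivclp_induct)
    case (step q r)
    then have "q \<doteq> r" using el[of q r] eqv_sym[OF el[of r q]] by blast
    with step.IH show ?case by (rule eqv_trans)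
  qed simp
qed

theorem abelian_subgroups_free:
  fixes H :: "('g, 'n) monoid_scheme"
  assumes a: "a \<in> verts K" and H: "comm_group H"
    and h: "h \<in> hom H (fundamental_group K a)" and inj: "inj_on h (carrier H)"
  shows "free_abelian H"
proof -
  interpret H: comm_group H by (rule H)
  interpret G: group "fundamental_group K a" by (rule group_fundamental_group[OF a])
  interpret h: group_hom H "fundamental_group K a" h
    by (simp add: group_hom_def group_hom_axioms_def h)
  let ?c = "\<lambda>p. homotopy K a a `` {p}"
  have car: "carrier (fundamental_group K a) = ?c ` loops K a"
    by (auto simp: fundamental_group_def quotient_def)
  have class_eq: "?c p = ?c q \<longleftrightarrow> p \<doteq> q" if "p \<in> loops K a" "q \<in> loops K a" for p q
    using eq_equiv_class_iff[OF equiv_homotopy that] homotopy_imp_eqv[of p q a a]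
      eqv_imp_homotopy[of p q a a] that by (auto simp: loops_def)
  have nil: "[] \<in> loops K a" using a by (simp add: loops_def)
  have one: "\<one>\<^bsub>fundamental_group K a\<^esub> = ?c []" by (simp add: fundamental_group_def)
  have app: "p @ q \<in> loops K a" if "p \<in> loops K a" "q \<in> loops K a" for p q
    using that by (auto simp: loops_def edge_path_append)
  have "\<exists>p\<in>loops K a. h x = ?c p" if "x \<in> carrier H" for x
    using h.hom_closed[OF that] car by auto
  then obtain rep where rep: "\<And>x. x \<in> carrier H \<Longrightarrow> rep x \<in> loops K a \<and> h x = ?c (rep x)"
    by metis
  have mult: "rep x @ rep y \<doteq> rep (x \<otimes>\<^bsub>H\<^esub> y)" if xy: "x \<in> carrier H" "y \<in> carrier H" for x y
  proof -
    have "?c (rep x @ rep y) = ?c (rep (x \<otimes>\<^bsub>H\<^esub> y))"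
      using rep[OF xy(1)] rep[OF xy(2)] rep[OF H.m_closed[OF xy]] h.hom_mult[OF xy]
        mult_fundamental_group[of "rep x" K a "rep y"] by metis
    then show ?thesis using class_eq app rep xy by simp
  qed
  have rep1: "rep x \<doteq> [] \<longleftrightarrow> x = \<one>\<^bsub>H\<^esub>" if x: "x \<in> carrier H" for x
    using class_eq[of "rep x" "[]"] rep[OF x] nil one inj_onD[OF inj, of x "\<one>\<^bsub>H\<^esub>"] x by auto
  (* Closing the set of chosen representatives under homotopy makes it closed under products. *)
  define A where "A = {p \<in> loops K a. \<exists>x\<in>carrier H. p \<doteq> rep x}"
  have repA: "rep x \<in> A" if "x \<in> carrier H" for x using rep[OF that] that by (auto simp: A_def)
  interpret commuting_subgroup "edges K" "einv K" ind res pos A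
  proof
    show "A \<subseteq> lists (edges K)"
    proof
      fix p assume "p \<in> A"
      then have "edge_path K a p a" by (simp add: A_def loops_def)
      then show "p \<in> lists (edges K)" by (rule edge_path_lists)
    qed
    show "[] \<in> A"
      using nil eqv_sym[of "rep \<one>\<^bsub>H\<^esub>" "[]"] rep1[OF H.one_closed] H.one_closed unfolding A_def by blast
  next
    fix p q assume "p \<in> A" "q \<in> A"
    then obtain x y where x: "p \<in> loops K a" "x \<in> carrier H" "p \<doteq> rep x"
      and y: "q \<in> loops K a" "y \<in> carrier H" "q \<doteq> rep y" by (auto simp: A_def)
    have pq: "p @ q \<doteq> rep (x \<otimes>\<^bsub>H\<^esub> y)"
      by (rule eqv_trans[OF eqv_append[OF x(3) y(3)] mult[OF x(2) y(2)]])
    then show "p @ q \<in> A"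
      unfolding A_def using app[OF x(1) y(1)] H.m_closed[OF x(2) y(2)] by blast
    have "q @ p \<doteq> rep (x \<otimes>\<^bsub>H\<^esub> y)"
      using eqv_trans[OF eqv_append[OF y(3) x(3)] mult[OF y(2) x(2)]] H.m_comm[OF x(2) y(2)] by simp
    from eqv_trans[OF pq eqv_sym[OF this]] show "p @ q \<doteq> q @ p" .
  next
    fix p assume "p \<in> A"
    then obtain x where x: "p \<in> loops K a" "x \<in> carrier H" "p \<doteq> rep x" by (auto simp: A_def)
    let ?y = "inv\<^bsub>H\<^esub> x"
    have "edge_path K a p a" using x(1) by (simp add: loops_def)
    then have pE: "p \<in> lists (edges K)" by (rule edge_path_lists)
    have "p @ rinv p \<doteq> []" by (rule rinv_right[OF pE])
    also have "[] \<doteq> rep (x \<otimes>\<^bsub>H\<^esub> ?y)"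
      using rep1[OF H.one_closed] x(2) by (simp add: eqv_commute)
    also have "\<dots> \<doteq> rep x @ rep ?y" by (rule eqv_sym[OF mult]) (use x(2) in auto)
    also have "\<dots> \<doteq> p @ rep ?y" by (rule eqv_append_right[OF eqv_sym[OF x(3)]])
    finally have "rinv p \<doteq> rep ?y" by (rule eqv_left_cancel[OF pE])
    moreover have "rinv p \<in> loops K a"
      using x(1) edge_path_inv[of a p a] by (simp add: loops_def rinv_def inv_path_def)
    ultimately show "rinv p \<in> A" unfolding A_def using H.inv_closed[OF x(2)] by blast
  qed
  show ?thesis
  proof (rule free_abelianI[OF H, of "\<lambda>x. crossings (rep x)"])
    fix x y X assume "x \<in> carrier H" "y \<in> carrier H"
    then show "crossings (rep (x \<otimes>\<^bsub>H\<^esub> y)) X = crossings (rep x) X + crossings (rep y) X"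
      using crossings_eqv[OF mult, of x y X] by (simp add: crossings_append repA)
  next
    fix x assume "x \<in> carrier H" "\<forall>X. crossings (rep x) X = 0"
    then show "x = \<one>\<^bsub>H\<^esub>" using crossings_detect[OF repA, of x] rep1 by simp
  qed (rule finite_crossings)
qed

end

section \<open>Disjoint occurrences of relator sides\<close>

fun left_of :: "'s squier_edge \<Rightarrow> 's squier_edge \<Rightarrow> bool" where
  "left_of (p, u, v, q) (p', u', v', q') \<longleftrightarrow> (\<exists>z. p' = p @ u @ z \<and> q = z @ u' @ q')"

definition disjoint_in :: "'s set \<Rightarrow> 's list rel \<Rightarrow> 's squier_edge \<Rightarrow> 's squier_edge \<Rightarrow> bool" where
  "disjoint_in \<Sigma> R e f \<longleftrightarrow> e \<in> edges (squier_complex \<Sigma> R) \<and> f \<in> edges (squier_complex \<Sigma> R) \<and>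
     (left_of e f \<or> left_of f e)"

text \<open>
  The occurrence of the first edge after the second one has been rewritten. The comparison of
  lengths recognises whether the first occurrence lies to the left. This is reliable since
  relator sides are nonempty. Only the context of the occurrence changes.
\<close>
fun residual :: "'s squier_edge \<Rightarrow> 's squier_edge \<Rightarrow> 's squier_edge" where
  "residual (p, u, v, q) (p', u', v', q') =
     (if length p < length p'
      then (p, u, v, take (length q - length (u' @ q')) q @ v' @ q')
      else (p' @ v' @ drop (length (p' @ u')) p, u, v, q))"

definition positive :: "'s list rel \<Rightarrow> 's squier_edge \<Rightarrow> bool" where
  "positive R = (\<lambda>(p, u, v, q). (u, v) \<in> R)"

lemma residual_left:
  "u \<noteq> [] \<Longrightarrow> residual (p, u, v, z @ u' @ q) (p @ u @ z, u', v', q) = (p, u, v, z @ v' @ q)"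
  by (cases u) auto

lemma residual_right:
  "residual (p @ u @ z, u', v', q) (p, u, v, z @ u' @ q) = (p @ v @ z, u', v', q)"
  by auto

lemma residual_simps:
  assumes "p' = p @ u @ z" "q = z @ u' @ q'" "u \<noteq> []"
  shows "residual (p, u, v, q) (p', u', v', q') = (p, u, v, z @ v' @ q')"
    and "residual (p', u', v', q') (p, u, v, q) = (p @ v @ z, u', v', q')"
  unfolding assms(1,2) by (rule residual_left[OF assms(3)], rule residual_right)

declare residual.simps [simp del]

context
  fixes \<Sigma> :: "'s set" and R :: "'s list rel"
  assumes pres: "semigroup_presentation \<Sigma> R"
begin

abbreviation "rel u v \<equiv> (u, v) \<in> R \<or> (v, u) \<in> R"

lemma rel_props: assumes "rel u v"
  shows "u \<noteq> []" "v \<noteq> []" "u \<in> lists \<Sigma>" "v \<in> lists \<Sigma>" "(u, v) \<in> R \<longleftrightarrow> (v, u) \<notin> R"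
  using assms pres by (auto simp: semigroup_presentation_def words1_def)

lemma edge_iff: "(p, u, v, q) \<in> edges (squier_complex \<Sigma> R) \<longleftrightarrow>
    p \<in> lists \<Sigma> \<and> q \<in> lists \<Sigma> \<and> rel u v"
  by (simp add: squier_complex_def)

lemma disjoint_inI:
  assumes "p' = p @ u @ z" "q = z @ u' @ q'" "rel u v" "rel u' v'"
    "p \<in> lists \<Sigma>" "z \<in> lists \<Sigma>" "q' \<in> lists \<Sigma>"
  shows "disjoint_in \<Sigma> R (p, u, v, q) (p', u', v', q')"
    and "disjoint_in \<Sigma> R (p', u', v', q') (p, u, v, q)"
  unfolding disjoint_in_def using assms rel_props[OF assms(3)] rel_props[OF assms(4)]
  by (simp_all add: edge_iff)

lemma disjoint_cases:
  assumes "disjoint_in \<Sigma> R e f"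
  obtains (left) p u v z u' v' q where "e = (p, u, v, z @ u' @ q)" "f = (p @ u @ z, u', v', q)"
      "rel u v" "rel u' v'" "p \<in> lists \<Sigma>" "z \<in> lists \<Sigma>" "q \<in> lists \<Sigma>" "u \<noteq> []" "v \<noteq> []"
  | (right) p u v z u' v' q where "f = (p, u, v, z @ u' @ q)" "e = (p @ u @ z, u', v', q)"
      "rel u v" "rel u' v'" "p \<in> lists \<Sigma>" "z \<in> lists \<Sigma>" "q \<in> lists \<Sigma>" "u \<noteq> []" "v \<noteq> []"
proof -
  obtain p u v q where e: "e = (p, u, v, q)" by (cases e) auto
  obtain p' u' v' q' where f: "f = (p', u', v', q')" by (cases f) auto
  have E: "p \<in> lists \<Sigma>" "q \<in> lists \<Sigma>" "rel u v" "p' \<in> lists \<Sigma>" "q' \<in> lists \<Sigma>" "rel u' v'"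
    using assms by (auto simp: disjoint_in_def e f edge_iff)
  note ne = rel_props(1,2)[OF E(3)] rel_props(1,2)[OF E(6)]
  have "left_of e f \<or> left_of f e" using assms by (simp add: disjoint_in_def)
  then show ?thesis
  proof
    assume "left_of e f"
    then obtain z where z: "p' = p @ u @ z" "q = z @ u' @ q'" by (auto simp: e f)
    then have "z \<in> lists \<Sigma>" using E by simp
    then show ?thesis using that(1)[of p u v z u' q' v'] e f z E ne by blast
  next
    assume "left_of f e"
    then obtain z where z: "p = p' @ u' @ z" "q' = z @ u @ q" by (auto simp: e f)
    then have "z \<in> lists \<Sigma>" using E by simp
    then show ?thesis using that(2)[of p' u' v' z u q v] e f z E ne by blast
  qed
qed

lemma left_of_trans: "left_of e f \<Longrightarrow> left_of f h \<Longrightarrow> left_of e h"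
  by (cases e; cases f; cases h) auto

lemma left_of_pos:
  assumes "left_of e f" "e \<in> edges (squier_complex \<Sigma> R)"
  shows "length (fst e) < length (fst f)"
proof -
  obtain p u v q where e: "e = (p, u, v, q)" by (cases e) auto
  then have "u \<noteq> []" using assms(2) rel_props(1)[of u v] by (simp add: edge_iff)
  then show ?thesis using assms(1) by (cases f) (auto simp: e)
qed

text \<open>
  Three disjoint occurrences, ordered from left to right. The other orders reduce to this one by
  symmetry.
\<close>
lemma left_triple:
  assumes E: "e \<in> edges (squier_complex \<Sigma> R)" "f \<in> edges (squier_complex \<Sigma> R)"
      "h \<in> edges (squier_complex \<Sigma> R)"
    and l: "left_of e f" "left_of f h"
  shows "disjoint_in \<Sigma> R (residual e f) (residual h f)" (is ?A)
    and "disjoint_in \<Sigma> R (residual e h) (residual f h)" (is ?B)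
    and "disjoint_in \<Sigma> R (residual f e) (residual h e)" (is ?C)
    and "residual (residual e f) (residual h f) = residual (residual e h) (residual f h)" (is ?D)
    and "residual (residual f e) (residual h e) = residual (residual f h) (residual e h)" (is ?E)
    and "residual (residual h e) (residual f e) = residual (residual h f) (residual e f)" (is ?F)
proof -
  obtain p u v z y u' v' y' u'' v'' q where
    e: "e = (p, u, v, z @ u' @ y @ u'' @ q)" and f: "f = (p @ u @ z, u', v', y @ u'' @ q)"
    and h: "h = (p @ u @ z @ u' @ y, u'', v'', q)"
    using l by (cases e; cases f; cases h) auto
  have r: "rel u v" "rel u' v'" "rel u'' v''" and L: "p \<in> lists \<Sigma>" "z \<in> lists \<Sigma>" "y \<in> lists \<Sigma>" "q \<in> lists \<Sigma>"
    using E by (auto simp: e f h edge_iff)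
  note n = rel_props[OF r(1)] rel_props[OF r(2)] rel_props[OF r(3)]
  have ef: "residual e f = (p, u, v, z @ v' @ y @ u'' @ q)"
    and fe: "residual f e = (p @ v @ z, u', v', y @ u'' @ q)"
    unfolding e f by (rule residual_simps; use n in simp)+
  have fh: "residual f h = (p @ u @ z, u', v', y @ v'' @ q)"
    and hf: "residual h f = ((p @ u @ z) @ v' @ y, u'', v'', q)"
    unfolding h f by (rule residual_simps; use n in simp)+
  have eh: "residual e h = (p, u, v, (z @ u' @ y) @ v'' @ q)"
    and he: "residual h e = (p @ v @ (z @ u' @ y), u'', v'', q)"
    unfolding e h by (rule residual_simps; use n in simp)+
  note N = rel_props(1)[OF r(1)] rel_props(1)[OF r(2)] rel_props(1)[OF r(3)]
  note 1 = residual_simps[where p' = "(p @ u @ z) @ v' @ y" and p = p and u = u and z = "z @ v' @ y"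
      and q = "z @ v' @ y @ u'' @ q" and u' = u'' and q' = q and v = v and v' = v'']
  note 2 = residual_simps[where p' = "p @ u @ z" and p = p and u = u and z = z
      and q = "(z @ u' @ y) @ v'' @ q" and u' = u' and q' = "y @ v'' @ q" and v = v and v' = v']
  note 3 = residual_simps[where p' = "p @ v @ (z @ u' @ y)" and p = "p @ v @ z" and u = u' and z = y
      and q = "y @ u'' @ q" and u' = u'' and q' = q and v = v' and v' = v'']
  show ?A unfolding ef hf by (rule disjoint_inI[of _ _ _ "z @ v' @ y"]) (use r L n in auto)
  show ?B unfolding eh fh by (rule disjoint_inI[of _ _ _ z]) (use r L n in auto)
  show ?C unfolding fe he by (rule disjoint_inI[of _ _ _ y]) (use r L n in auto)
  show ?D unfolding ef hf eh fh using 1(1) 2(1) N by simp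
  show ?E unfolding fe he eh fh using 3(1) 2(2) N by simp
  show ?F unfolding ef he hf fe using 3(2) 1(2) N by simp
qed

lemma disjoint_sym: "disjoint_in \<Sigma> R e f \<Longrightarrow> disjoint_in \<Sigma> R f e"
  by (auto simp: disjoint_in_def)

lemma residual_cube:
  assumes d: "disjoint_in \<Sigma> R e f" "disjoint_in \<Sigma> R e h" "disjoint_in \<Sigma> R f h"
  shows "disjoint_in \<Sigma> R (residual e h) (residual f h) \<and>
    residual (residual e h) (residual f h) = residual (residual e f) (residual h f)"
proof -
  have E: "e \<in> edges (squier_complex \<Sigma> R)" "f \<in> edges (squier_complex \<Sigma> R)"
      "h \<in> edges (squier_complex \<Sigma> R)"
    using d by (auto simp: disjoint_in_def)
  have "left_of e f \<and> left_of f h \<or> left_of e h \<and> left_of h f \<or> left_of f e \<and> left_of e h \<or>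
      left_of f h \<and> left_of h e \<or> left_of h e \<and> left_of e f \<or> left_of h f \<and> left_of f e"
    using d left_of_trans unfolding disjoint_in_def by metis
  then show ?thesis
  proof (elim disjE conjE)
    assume l: "left_of e f" "left_of f h"
    show ?thesis using left_triple[OF E(1,2,3) l] by simp
  next
    assume l: "left_of e h" "left_of h f"
    show ?thesis using left_triple[OF E(1,3,2) l] by simp
  next
    assume l: "left_of f e" "left_of e h"
    show ?thesis using left_triple[OF E(2,1,3) l] disjoint_sym by metis
  next
    assume l: "left_of f h" "left_of h e"
    show ?thesis using left_triple[OF E(2,3,1) l] disjoint_sym by metis
  next
    assume l: "left_of h e" "left_of e f"
    show ?thesis using left_triple[OF E(3,1,2) l] by metis
  next
    assume l: "left_of h f" "left_of f e"
    show ?thesis using left_triple[OF E(3,2,1) l] disjoint_sym by metis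
  qed
qed

lemma square_complex_squier:
  "square_complex (squier_complex \<Sigma> R) (disjoint_in \<Sigma> R) residual (positive R)"
proof -
  let ?K = "squier_complex \<Sigma> R" and ?d = "disjoint_in \<Sigma> R"
  interpret complex2 ?K by (rule complex2_squier_complex[OF pres])
  have K: "src ?K (p, u, v, q) = p @ u @ q" "tgt ?K (p, u, v, q) = p @ v @ q"
    "einv ?K (p, u, v, q) = (p, v, u, q)" for p u v q
    by (simp_all add: squier_complex_def)
  note rs = residual_simps[OF refl refl]
  show ?thesis
  proof unfold_locales
    fix e show "einv ?K (einv ?K e) = e" by (cases e) (simp add: K)
  next
    fix e assume "e \<in> edges ?K" then show "einv ?K e \<in> edges ?K" by (rule einv_edges)
  next
    fix e assume e: "e \<in> edges ?K"
    obtain p u v q where puvq: "e = (p, u, v, q)" by (cases e) auto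
    have "rel u v" using e by (simp add: puvq edge_iff)
    from rel_props(5)[OF this] show "positive R (einv ?K e) \<longleftrightarrow> \<not> positive R e"
      by (simp add: puvq K positive_def)
  next
    fix e f assume "?d e f" then show "e \<in> edges ?K" by (simp add: disjoint_in_def)
  next
    fix e f assume "?d e f" then show "?d f e" by (rule disjoint_sym)
  next
    fix e show "\<not> ?d e e" using left_of_pos[of e e] by (auto simp: disjoint_in_def)
  next
    fix e f assume "?d e f"
    then show "?d (einv ?K e) (residual f e)"
    proof (cases rule: disjoint_cases)
      case (left p u v z u' v' q)
      show ?thesis
        unfolding left(1,2) K rs(2)[OF left(8)]
        by (rule disjoint_inI(1)[OF refl refl]) (use left in auto)
    next
      case (right p u v z u' v' q)
      show ?thesis
        unfolding right(1,2) K rs(1)[OF right(8)]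
        by (rule disjoint_inI(2)[OF refl refl]) (use right in auto)
    qed
  next
    fix e f assume "?d e f"
    then show "residual e f \<in> edges ?K"
    proof (cases rule: disjoint_cases)
      case (left p u v z u' v' q)
      then show ?thesis using rel_props(4)[OF left(4)] by (simp add: rs edge_iff)
    next
      case (right p u v z u' v' q)
      then show ?thesis using rel_props(4)[OF right(3)] by (simp add: rs edge_iff)
    qed
  next
    fix e f assume "?d e f"
    then show "positive R (residual e f) \<longleftrightarrow> positive R e"
      by (cases rule: disjoint_cases) (simp_all add: rs positive_def)
  next
    fix e f assume "?d e f"
    then show "residual (residual f e) (einv ?K e) = f"
    proof (cases rule: disjoint_cases)
      case (left p u v z u' v' q)
      then show ?thesis by (simp add: rs K)
    next
      case (right p u v z u' v' q)
      then show ?thesis by (simp add: rs K)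
    qed
  next
    fix e f assume "?d e f"
    then show "residual (einv ?K e) (residual f e) = einv ?K (residual e f)"
    proof (cases rule: disjoint_cases)
      case (left p u v z u' v' q)
      then show ?thesis by (simp add: rs K)
    next
      case (right p u v z u' v' q)
      then show ?thesis by (simp add: rs K)
    qed
  next
    fix e f h assume "?d e f" "?d e h" "?d f h"
    then show "?d (residual e h) (residual f h)" using residual_cube by blast
  next
    fix e f h assume "?d e f" "?d e h" "?d f h"
    then show "residual (residual e h) (residual f h) = residual (residual e f) (residual h f)"
      using residual_cube by blast
  next
    fix e f assume "?d e f" then show "src ?K e = src ?K f"
      by (cases rule: disjoint_cases) (simp_all add: K)
  next
    fix e f assume "?d e f" then show "src ?K (residual e f) = tgt ?K f"
      by (cases rule: disjoint_cases) (simp_all add: K rs)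
  next
    fix e f assume "?d e f" then show "tgt ?K (residual e f) = tgt ?K (residual f e)"
      by (cases rule: disjoint_cases) (simp_all add: K rs)
  next
    fix c assume "c \<in> cells ?K"
    then obtain p z q l r l' r' where
      c: "c = [(p, l, r, z @ l' @ q), (p @ r @ z, l', r', q), (p, r, l, z @ r' @ q), (p @ l @ z, r', l', q)]"
      and w: "p \<in> lists \<Sigma>" "z \<in> lists \<Sigma>" "q \<in> lists \<Sigma>" "(l, r) \<in> R" "(l', r') \<in> R"
      unfolding squier_complex_def complex2.select_convs by blast
    let ?a = "(p, l, r, z @ l' @ q)" and ?b = "(p @ l @ z, l', r', q)"
    have "?d ?a ?b" using w by (intro disjoint_inI(1)[OF refl refl]) auto
    moreover have "c = [?a, residual ?b ?a, einv ?K (residual ?a ?b), einv ?K ?b]"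
      using rel_props(1)[of l r] w(4) by (simp add: c rs K)
    ultimately show "\<exists>a b. ?d a b \<and> c = [a, residual b a, einv ?K (residual a b), einv ?K b]"
      by blast
  next
    have *: "[a, residual b a, einv ?K (residual a b), einv ?K b] \<in> cells ?K"
      if "a = (p, u, v, z @ u' @ q)" "b = (p @ u @ z, u', v', q)" "u \<noteq> []"
        "p \<in> lists \<Sigma>" "z \<in> lists \<Sigma>" "q \<in> lists \<Sigma>" "positive R a" "positive R b"
      for a b p u v z u' v' q
    proof -
      have eq: "[a, residual b a, einv ?K (residual a b), einv ?K b] =
        [(p, u, v, z @ u' @ q), (p @ v @ z, u', v', q), (p, v, u, z @ v' @ q), (p @ u @ z, v', u', q)]"
        using that by (simp add: rs K)
      show ?thesis
        unfolding eq
        unfolding squier_complex_def complex2.select_convs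
        by (rule CollectI, rule exI[of _ p], rule exI[of _ z], rule exI[of _ q], rule exI[of _ u],
            rule exI[of _ v], rule exI[of _ u'], rule exI[of _ v'])
          (use that in \<open>simp add: positive_def\<close>)
    qed
    fix a b assume d: "?d a b" and ab: "positive R a" "positive R b"
    from d show "[a, residual b a, einv ?K (residual a b), einv ?K b] \<in> cells ?K \<or>
      [b, residual a b, einv ?K (residual b a), einv ?K a] \<in> cells ?K"
    proof (cases rule: disjoint_cases)
      case (left p u v z u' v' q)
      then show ?thesis using *[OF left(1,2,8,5,6,7) ab] by blast
    next
      case (right p u v z u' v' q)
      then show ?thesis using *[OF right(1,2,8,5,6,7) ab(2,1)] by blast
    qed
  qed
qed

end

theorem theorem16:
  fixes \<Sigma> :: "'s set" and R :: "'s list rel" and w :: "'s list"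
    and G :: "('g, 'm) monoid_scheme" and A :: "'g set"
  assumes "semigroup_presentation \<Sigma> R"
    and "w \<in> words1 \<Sigma>"
    and "group G"
    and "G \<cong> diagram_group \<Sigma> R w"
    and "subgroup A G"
    and "comm_group (G\<lparr>carrier := A\<rparr>)"
  shows "free_abelian (G\<lparr>carrier := A\<rparr>)"
proof -
  interpret square_complex "squier_complex \<Sigma> R" "disjoint_in \<Sigma> R" residual "positive R"
    by (rule square_complex_squier[OF assms(1)])
  obtain f where f: "f \<in> iso G (diagram_group \<Sigma> R w)" using assms(4) by (auto simp: is_iso_def)
  have sub: "A \<subseteq> carrier G" by (rule subgroup.subset[OF assms(5)])
  show ?thesis
  proof (rule abelian_subgroups_free[OF _ assms(6), of w f])
    show "w \<in> verts (squier_complex \<Sigma> R)" using assms(2) by (simp add: squier_complex_def)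
    have hom: "f \<in> hom G (fundamental_group (squier_complex \<Sigma> R) w)"
      using f by (simp add: iso_def diagram_group_def)
    show "f \<in> hom (G\<lparr>carrier := A\<rparr>) (fundamental_group (squier_complex \<Sigma> R) w)"
    proof (rule homI)
      fix x y assume "x \<in> carrier (G\<lparr>carrier := A\<rparr>)" "y \<in> carrier (G\<lparr>carrier := A\<rparr>)"
      then show "f (x \<otimes>\<^bsub>G\<lparr>carrier := A\<rparr>\<^esub> y) = f x \<otimes>\<^bsub>fundamental_group (squier_complex \<Sigma> R) w\<^esub> f y"
        using hom_mult[OF hom, of x y] sub by auto
    qed (use sub hom_in_carrier[OF hom] in auto)
    show "inj_on f (carrier (G\<lparr>carrier := A\<rparr>))"
      using f sub by (auto simp: iso_def bij_betw_def intro: inj_on_subset)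
  qed
qed

end
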